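(* Let $n\ge 1$ and $0\le r\le n$. Then $a_{n,r}=P(n,r,[r(n+1)/2])$, where $[x]$ denotes the greatest integer not greater than $x$. In particular, $$a_n=\sum_{r=0}^n P\left(n,r,\left[\tfrac{r(n+1)}{2}\right]\right).$$
   Context: $\mathsf{S}_n$ is the $n\times n$ integer matrix with $1$'s on the diagonal and on the superdiagonal and $0$'s elsewhere, and $a_{n,r}:=\mathrm{rank}\ker(\wedge^r\mathsf{S}_n-\mathsf{I})$, where $\wedge^r\mathsf{S}_n$ is the $r$-th exterior power acting on $\Lambda^r\mathbb{Z}^n$. $a_n$ denotes the common rank of $K_0(\mathscr{A}_{n,\theta})$ and $K_1(\mathscr{A}_{n,\theta})$, where $\mathscr{A}_{n,\theta}=\mathcal{C}(\mathbb{T}^n)\rtimes_\sigma\mathbb{Z}$ ($\theta\in\mathbb{R}$), the action on $\mathcal{C}(\mathbb{T}^n)$ is $f\mapsto f\circ\sigma^{-1}$, and $\sigma$ is the Anzai transformation $\sigma^{-1}(\zeta_1,\dots,\zeta_n)=(e^{2\pi i\theta}\zeta_1,\zeta_1\zeta_2,\dots,\zeta_{n-1}\zeta_n)$; one has $a_n=\sum_{r=0}^n a_{n,r}$. For positive integers $n,r,k$, $P(n,r,k)$ is the number of partitions of $k$ into $r$ distinct positive integers not greater than $n$: $P(n,r,k)=\mathrm{card}\{(i_1,\dots,i_r)\mid i_1+\dots+i_r=k,\ 1\le i_1<\dots<i_r\le n\}$. By convention $P(n,0,0)=1$ and $P(n,r,0)=P(n,0,k)=0$ for $r,k\ge1$.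 *)

theory Defs
  imports
    "HOL-Analysis.Function_Topology"
    "HOL-Library.Extended_Nat"
    "HOL-Algebra.Free_Abelian_Groups"
    "HOL-Algebra.QuotRing"
    "Jordan_Normal_Form.Matrix"
begin

section \<open>Rank of an abelian group\<close>

definition int_independent :: "('a, 'm) monoid_scheme \<Rightarrow> 'a set \<Rightarrow> bool" where
  "int_independent G B \<longleftrightarrow> finite B \<and> B \<subseteq> carrier G \<and>
     (\<forall>c :: 'a \<Rightarrow> int. (\<Otimes>\<^bsub>G\<^esub>b\<in>B. b [^]\<^bsub>G\<^esub> c b) = \<one>\<^bsub>G\<^esub> \<longrightarrow> (\<forall>b\<in>B. c b = 0))"

definition group_rank :: "('a, 'm) monoid_scheme \<Rightarrow> enat" where
  "group_rank G = (SUP B \<in> {B. int_independent G B}. enat (card B))"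


section \<open>Exterior powers\<close>

text \<open>
  The free abelian group on all \<open>r\<close>-tuples of vectors of \<open>\<int>\<^sup>n\<close>, divided by the relations
  that make \<open>(v\<^sub>1, \<dots>, v\<^sub>r) \<mapsto> v\<^sub>1 \<and> \<dots> \<and> v\<^sub>r\<close> multilinear and alternating.
\<close>

definition vec_tuples :: "nat \<Rightarrow> nat \<Rightarrow> int vec list set" where
  "vec_tuples n r = {vs. length vs = r \<and> set vs \<subseteq> carrier_vec n}"

definition wedge_relations :: "nat \<Rightarrow> nat \<Rightarrow> (int vec list \<Rightarrow>\<^sub>0 int) set" where
  "wedge_relations n r =
     {frag_of (vs[i := v + w]) - frag_of (vs[i := v]) - frag_of (vs[i := w]) | vs i v w.
        vs \<in> vec_tuples n r \<and> i < r \<and> v \<in> carrier_vec n \<and> w \<in> carrier_vec n} \<union>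
     {frag_of (vs[i := c \<cdot>\<^sub>v v]) - frag_cmul c (frag_of (vs[i := v])) | vs i c v.
        vs \<in> vec_tuples n r \<and> i < r \<and> v \<in> carrier_vec n} \<union>
     {frag_of vs | vs i j. vs \<in> vec_tuples n r \<and> i < j \<and> j < r \<and> vs ! i = vs ! j}"

definition wedge_null :: "nat \<Rightarrow> nat \<Rightarrow> (int vec list \<Rightarrow>\<^sub>0 int) set" where
  "wedge_null n r = generate (free_Abelian_group (vec_tuples n r)) (wedge_relations n r)"

definition ext_power :: "nat \<Rightarrow> nat \<Rightarrow> (int vec list \<Rightarrow>\<^sub>0 int) set monoid" where
  "ext_power n r = free_Abelian_group (vec_tuples n r) Mod wedge_null n r"

text \<open>
  The endomorphism of the exterior power with
  \<open>v\<^sub>1 \<and> \<dots> \<and> v\<^sub>r \<mapsto> T v\<^sub>1 \<and> \<dots> \<and> T v\<^sub>r\<close>; all cosets in the union below coincide.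
\<close>

definition ext_power_map ::
  "nat \<Rightarrow> nat \<Rightarrow> int mat \<Rightarrow> (int vec list \<Rightarrow>\<^sub>0 int) set \<Rightarrow> (int vec list \<Rightarrow>\<^sub>0 int) set" where
  "ext_power_map n r T X =
     (\<Union>x\<in>X. wedge_null n r #>\<^bsub>free_Abelian_group (vec_tuples n r)\<^esub>
        frag_extend (\<lambda>vs. frag_of (map (\<lambda>v. T *\<^sub>v v) vs)) x)"

definition S_mat :: "nat \<Rightarrow> int mat" where
  "S_mat n = mat n n (\<lambda>(i, j). if j = i \<or> j = i + 1 then 1 else 0)"

definition fixed_part :: "nat \<Rightarrow> nat \<Rightarrow> (int vec list \<Rightarrow>\<^sub>0 int) set monoid" where
  "fixed_part n r = (ext_power n r)\<lparr>carrier :=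
     kernel (ext_power n r) (ext_power n r)
       (\<lambda>X. ext_power_map n r (S_mat n) X \<otimes>\<^bsub>ext_power n r\<^esub> inv\<^bsub>ext_power n r\<^esub> X)\<rparr>"

definition a_coeff :: "nat \<Rightarrow> nat \<Rightarrow> enat" where
  "a_coeff n r = group_rank (fixed_part n r)"


section \<open>Partitions into distinct parts\<close>

text \<open>For \<open>r = 0\<close> or \<open>k = 0\<close> the value is \<open>1\<close> if both vanish and \<open>0\<close> if exactly one
  does, as is customary.\<close>

definition partition_count :: "nat \<Rightarrow> nat \<Rightarrow> nat \<Rightarrow> nat" where
  "partition_count n r k = card {is :: nat list.
     length is = r \<and> sum_list is = k \<and> sorted_wrt (<) is \<and> set is \<subseteq> {1..n}}"


section \<open>Star algebras and their enveloping C*-algebras\<close>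

record 'a star_algebra = "(complex, 'a) module" +
  star :: "'a \<Rightarrow> 'a"

record 'a cstar_algebra = "'a star_algebra" +
  cnorm :: "'a \<Rightarrow> real"

definition cstar_seminorm :: "('a, 'm) star_algebra_scheme \<Rightarrow> ('a \<Rightarrow> real) \<Rightarrow> bool" where
  "cstar_seminorm A p \<longleftrightarrow>
     (\<forall>x\<in>carrier A. 0 \<le> p x) \<and>
     (\<forall>x\<in>carrier A. \<forall>y\<in>carrier A. p (x \<oplus>\<^bsub>A\<^esub> y) \<le> p x + p y) \<and>
     (\<forall>c. \<forall>x\<in>carrier A. p (c \<odot>\<^bsub>A\<^esub> x) = cmod c * p x) \<and>
     (\<forall>x\<in>carrier A. \<forall>y\<in>carrier A. p (x \<otimes>\<^bsub>A\<^esub> y) \<le> p x * p y) \<and>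
     (\<forall>x\<in>carrier A. p (star A x \<otimes>\<^bsub>A\<^esub> x) = (p x)\<^sup>2)"

text \<open>Meaningful when the C*-seminorms are pointwise bounded, as they are for the algebras
  \<open>C\<^sub>c(\<int>, B)\<close> with \<open>B\<close> a C*-algebra (by the \<open>\<ell>\<^sup>1\<close>-norm).\<close>

definition env_norm :: "('a, 'm) star_algebra_scheme \<Rightarrow> 'a \<Rightarrow> real" where
  "env_norm A x = (SUP p \<in> {p. cstar_seminorm A p}. p x)"

text \<open>The completion for \<^const>\<open>env_norm\<close>: Cauchy sequences modulo null sequences.\<close>

definition cauchy_ring :: "('a, 'm) star_algebra_scheme \<Rightarrow> (nat \<Rightarrow> 'a) ring" where
  "cauchy_ring A = \<lparr>
     carrier = {x. (\<forall>k. x k \<in> carrier A) \<and>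
       (\<forall>e>0. \<exists>M. \<forall>i\<ge>M. \<forall>j\<ge>M. env_norm A (x i \<ominus>\<^bsub>A\<^esub> x j) < e)},
     monoid.mult = (\<lambda>x y k. x k \<otimes>\<^bsub>A\<^esub> y k),
     one = (\<lambda>k. \<one>\<^bsub>A\<^esub>),
     zero = (\<lambda>k. \<zero>\<^bsub>A\<^esub>),
     add = (\<lambda>x y k. x k \<oplus>\<^bsub>A\<^esub> y k)\<rparr>"

definition null_seqs :: "('a, 'm) star_algebra_scheme \<Rightarrow> (nat \<Rightarrow> 'a) set" where
  "null_seqs A = {x \<in> carrier (cauchy_ring A). (\<lambda>k. env_norm A (x k)) \<longlonglongrightarrow> 0}"

text \<open>Adding the null sequences to the image of a coset under scalar multiplication only
  matters for the scalar \<open>0\<close>.\<close>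

definition enveloping_cstar ::
  "('a, 'm) star_algebra_scheme \<Rightarrow> (nat \<Rightarrow> 'a) set cstar_algebra" where
  "enveloping_cstar A = (let Q = cauchy_ring A Quot null_seqs A in \<lparr>
     carrier = carrier Q,
     monoid.mult = monoid.mult Q,
     one = one Q,
     zero = zero Q,
     add = add Q,
     smult = (\<lambda>c X. null_seqs A <+>\<^bsub>cauchy_ring A\<^esub> (\<lambda>x k. c \<odot>\<^bsub>A\<^esub> x k) ` X),
     star = (\<lambda>X. (\<lambda>x k. star A (x k)) ` X),
     cnorm = (\<lambda>X. THE l. \<forall>x\<in>X. (\<lambda>k. env_norm A (x k)) \<longlonglongrightarrow> l)\<rparr>)"


section \<open>The crossed product by the Anzai transformation\<close>

definition torus :: "nat \<Rightarrow> (nat \<Rightarrow> complex) set" where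
  "torus n = {1..n} \<rightarrow>\<^sub>E {w. cmod w = 1}"

text \<open>Elements of \<open>C(\<T>\<^sup>n)\<close> are represented by their extension by \<open>0\<close> to the ambient type.\<close>

definition cont_torus :: "nat \<Rightarrow> ((nat \<Rightarrow> complex) \<Rightarrow> complex) set" where
  "cont_torus n = {f. continuous_on (torus n) f \<and> (\<forall>z. z \<notin> torus n \<longrightarrow> f z = 0)}"

text \<open>This is \<open>\<sigma>\<^sup>-\<^sup>1\<close>, not \<open>\<sigma>\<close>.\<close>

definition anzai_inv :: "nat \<Rightarrow> real \<Rightarrow> (nat \<Rightarrow> complex) \<Rightarrow> nat \<Rightarrow> complex" where
  "anzai_inv n \<theta> z =
     (\<lambda>i\<in>{1..n}. if i = 1 then exp (2 * of_real pi * \<i> * of_real \<theta>) * z 1 else z (i - 1) * z i)"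

definition anzai_inv_pow :: "nat \<Rightarrow> real \<Rightarrow> int \<Rightarrow> (nat \<Rightarrow> complex) \<Rightarrow> nat \<Rightarrow> complex" where
  "anzai_inv_pow n \<theta> l =
     (if 0 \<le> l then anzai_inv n \<theta> ^^ nat l
      else inv_into (torus n) (anzai_inv n \<theta>) ^^ nat (- l))"

text \<open>The \<open>l\<close>-th power of the automorphism \<open>f \<mapsto> f \<circ> \<sigma>\<^sup>-\<^sup>1\<close>.\<close>

definition anzai_action ::
  "nat \<Rightarrow> real \<Rightarrow> int \<Rightarrow> ((nat \<Rightarrow> complex) \<Rightarrow> complex) \<Rightarrow> (nat \<Rightarrow> complex) \<Rightarrow> complex" where
  "anzai_action n \<theta> l f = (\<lambda>z. if z \<in> torus n then f (anzai_inv_pow n \<theta> l z) else 0)"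

text \<open>
  The convolution algebra \<open>C\<^sub>c(\<int>, C(\<T>\<^sup>n))\<close>; \<open>a\<close> stands for the finite sum of the \<open>a l u\<^sup>l\<close>, where
  \<open>u\<close> is the implementing unitary, \<open>u f u\<^sup>* = f \<circ> \<sigma>\<^sup>-\<^sup>1\<close>.
\<close>

definition anzai_conv_algebra ::
  "nat \<Rightarrow> real \<Rightarrow> (int \<Rightarrow> (nat \<Rightarrow> complex) \<Rightarrow> complex) star_algebra" where
  "anzai_conv_algebra n \<theta> = \<lparr>
     carrier = {a. finite {l. a l \<noteq> (\<lambda>z. 0)} \<and> (\<forall>l. a l \<in> cont_torus n)},
     monoid.mult = (\<lambda>a b k z. \<Sum>l | a l \<noteq> (\<lambda>z. 0). a l z * anzai_action n \<theta> l (b (k - l)) z),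
     one = (\<lambda>k z. if k = 0 \<and> z \<in> torus n then 1 else 0),
     zero = (\<lambda>k z. 0),
     add = (\<lambda>a b k z. a k z + b k z),
     smult = (\<lambda>c a k z. c * a k z),
     star = (\<lambda>a k. anzai_action n \<theta> k (\<lambda>z. cnj (a (- k) z)))\<rparr>"

text \<open>
  The full crossed product \<open>C(\<T>\<^sup>n) \<rtimes>\<^sub>\<sigma> \<int>\<close>. Its norm, the supremum over all covariant
  representations, is the largest C*-seminorm of the convolution algebra, since every
  C*-seminorm comes from a representation on a Hilbert space.
\<close>

definition anzai_cstar ::
  "nat \<Rightarrow> real \<Rightarrow> (nat \<Rightarrow> int \<Rightarrow> (nat \<Rightarrow> complex) \<Rightarrow> complex) set cstar_algebra" where
  "anzai_cstar n \<theta> = enveloping_cstar (anzai_conv_algebra n \<theta>)"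


section \<open>Matrices over a unital C*-algebra\<close>

text \<open>Only the container type of matrices is taken from the library, since the entries live
  in the carrier of a record rather than in a type class.\<close>

definition cs_mats :: "('a, 'm) cstar_algebra_scheme \<Rightarrow> nat \<Rightarrow> nat \<Rightarrow> 'a mat set" where
  "cs_mats A k l = {x \<in> carrier_mat k l. elements_mat x \<subseteq> carrier A}"

definition cs_mult :: "('a, 'm) cstar_algebra_scheme \<Rightarrow> 'a mat \<Rightarrow> 'a mat \<Rightarrow> 'a mat" where
  "cs_mult A x y = mat (dim_row x) (dim_col y)
     (\<lambda>(i, j). \<Oplus>\<^bsub>A\<^esub>k\<in>{..<dim_col x}. x $$ (i, k) \<otimes>\<^bsub>A\<^esub> y $$ (k, j))"

definition cs_adj :: "('a, 'm) cstar_algebra_scheme \<Rightarrow> 'a mat \<Rightarrow> 'a mat" where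
  "cs_adj A x = mat (dim_col x) (dim_row x) (\<lambda>(i, j). star A (x $$ (j, i)))"

definition cs_one :: "('a, 'm) cstar_algebra_scheme \<Rightarrow> nat \<Rightarrow> 'a mat" where
  "cs_one A k = mat k k (\<lambda>(i, j). if i = j then \<one>\<^bsub>A\<^esub> else \<zero>\<^bsub>A\<^esub>)"

definition cs_dsum :: "('a, 'm) cstar_algebra_scheme \<Rightarrow> 'a mat \<Rightarrow> 'a mat \<Rightarrow> 'a mat" where
  "cs_dsum A x y = four_block_mat x
     (mat (dim_row x) (dim_col y) (\<lambda>_. \<zero>\<^bsub>A\<^esub>))
     (mat (dim_row y) (dim_col x) (\<lambda>_. \<zero>\<^bsub>A\<^esub>)) y"


section \<open>The group K0\<close>

definition cs_projections :: "('a, 'm) cstar_algebra_scheme \<Rightarrow> 'a mat set" where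
  "cs_projections A = (\<Union>k. {p \<in> cs_mats A k k. cs_mult A p p = p \<and> cs_adj A p = p})"

text \<open>Murray-von Neumann equivalence, also between projections of different sizes.\<close>

definition mvn_equiv :: "('a, 'm) cstar_algebra_scheme \<Rightarrow> 'a mat \<Rightarrow> 'a mat \<Rightarrow> bool" where
  "mvn_equiv A p q \<longleftrightarrow> (\<exists>v \<in> cs_mats A (dim_row q) (dim_row p).
     p = cs_mult A (cs_adj A v) v \<and> q = cs_mult A v (cs_adj A v))"

text \<open>Formal differences of projections: \<open>(p, q)\<close> stands for \<open>[p] - [q]\<close>.\<close>

definition K0_rel :: "('a, 'm) cstar_algebra_scheme \<Rightarrow> (('a mat \<times> 'a mat) \<times> ('a mat \<times> 'a mat)) set" where
  "K0_rel A = {((p, q), (p', q')).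
     p \<in> cs_projections A \<and> q \<in> cs_projections A \<and>
     p' \<in> cs_projections A \<and> q' \<in> cs_projections A \<and>
     (\<exists>s \<in> cs_projections A.
        mvn_equiv A (cs_dsum A (cs_dsum A p q') s) (cs_dsum A (cs_dsum A p' q) s))}"

definition K0 :: "('a, 'm) cstar_algebra_scheme \<Rightarrow> ('a mat \<times> 'a mat) set monoid" where
  "K0 A = \<lparr>
     carrier = (cs_projections A \<times> cs_projections A) // K0_rel A,
     monoid.mult = (\<lambda>X Y. K0_rel A ``
       {(cs_dsum A p p', cs_dsum A q q') | p q p' q'. (p, q) \<in> X \<and> (p', q') \<in> Y}),
     one = K0_rel A `` {(cs_one A 0, cs_one A 0)}\<rparr>"


section \<open>The group K1\<close>

definition cs_unitaries :: "('a, 'm) cstar_algebra_scheme \<Rightarrow> nat \<Rightarrow> 'a mat set" where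
  "cs_unitaries A k = {u \<in> cs_mats A k k.
     cs_mult A (cs_adj A u) u = cs_one A k \<and> cs_mult A u (cs_adj A u) = cs_one A k}"

text \<open>Homotopy in the unitary group of the matrix algebra. Its norm topology is the topology of
  entrywise norm convergence.\<close>

definition unitary_homotopic ::
  "('a, 'm) cstar_algebra_scheme \<Rightarrow> nat \<Rightarrow> 'a mat \<Rightarrow> 'a mat \<Rightarrow> bool" where
  "unitary_homotopic A k u v \<longleftrightarrow> (\<exists>\<gamma> :: real \<Rightarrow> 'a mat.
     (\<forall>t\<in>{0..1}. \<gamma> t \<in> cs_unitaries A k) \<and> \<gamma> 0 = u \<and> \<gamma> 1 = v \<and>
     (\<forall>t\<in>{0..1}. \<forall>i<k. \<forall>j<k.
        ((\<lambda>s. cnorm A (\<gamma> s $$ (i, j) \<ominus>\<^bsub>A\<^esub> \<gamma> t $$ (i, j))) \<longlongrightarrow> 0) (at t within {0..1})))"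

definition K1_rel :: "('a, 'm) cstar_algebra_scheme \<Rightarrow> ('a mat \<times> 'a mat) set" where
  "K1_rel A = {(u, v). \<exists>k l m. u \<in> cs_unitaries A k \<and> v \<in> cs_unitaries A l \<and> k \<le> m \<and> l \<le> m \<and>
     unitary_homotopic A m (cs_dsum A u (cs_one A (m - k))) (cs_dsum A v (cs_one A (m - l)))}"

definition K1 :: "('a, 'm) cstar_algebra_scheme \<Rightarrow> 'a mat set monoid" where
  "K1 A = \<lparr>
     carrier = (\<Union>k. cs_unitaries A k) // K1_rel A,
     monoid.mult = (\<lambda>X Y. K1_rel A `` {cs_dsum A u v | u v. u \<in> X \<and> v \<in> Y}),
     one = K1_rel A `` {cs_one A 0}\<rparr>"

end

theory Submission
  imports Defs "Jordan_Normal_Form.Determinant"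
begin

text \<open>
  The basis \<open>e\<^sub>A\<close> of the exterior power is indexed by the \<open>r\<close>-subsets \<open>A\<close> of \<open>{0..m}\<close>, \<open>n = m + 1\<close>, and is
  graded by the sum of \<open>A\<close>. In this basis the exterior power of \<open>S\<close> minus the identity strictly
  lowers the degree, and its part of degree \<open>-1\<close> is the operator \<open>E\<close> that moves one index \<open>i + 1\<close>
  down to \<open>i\<close>. With a suitably weighted \<open>F\<close> moving indices up, \<open>[E, F]\<close> acts in degree \<open>k\<close> as
  \<open>r m - 2 k\<close> and \<open>F\<close> is adjoint to \<open>E\<close> for a positive definite form, so that
  \<open>|F f|\<^sup>2 = |E f|\<^sup>2 + (r m - 2 k) |f|\<^sup>2\<close>. Hence \<open>E\<close> is injective above the middle degree
  \<open>\<mu> = [r m / 2]\<close> and its transpose is injective below it. Consequently every fixed vector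
  lives in degrees at most \<open>\<mu>\<close>, and the equations for it, one for each basis vector of degree
  less than \<open>\<mu>\<close>, are linearly independent; so the rank is the number of basis vectors of
  degree \<open>\<mu>\<close>.
\<close>

section \<open>Ranks of integral kernels\<close>

text \<open>The shift minus the identity is not homogeneous, so its kernel need not split into
  degrees. What makes \<open>E\<close> decisive is triangularity: next to the top component of a
  fixed vector, or to the bottom component of a relation between the equations, the neighbouring
  degree sees no part of the operator except \<open>E\<close>. The equations in degree
  \<open>\<mu>\<close> and above hold by themselves for vectors living in degrees at most
  \<open>\<mu>\<close>, whence the difference of two counts. Functions on \<open>r\<close>-sets
  carry the \<open>r\<close>-th exterior power of the irreducible sl2-module of dimension
  \<open>m + 1\<close>. Since \<open>E\<close> moves indices with coefficient 1, all structure
  constants \<open>(i + 1) (m - i)\<close> fall on \<open>F\<close>. Positivity of the form replaces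
  the classification of modules, at the price of working over the reals; the rank itself is found by
  integral linear algebra. The exterior power is given as a quotient of a free group on tuples of
  vectors, so its basis has to be earned: minors give independence, sorting of unit vectors gives
  spanning.\<close>

text \<open>Fraction-free Gaussian elimination, one equation at a time: cross-multiplying with the
  pivot \<open>A i p\<close> removes the unknown \<open>p\<close> from the remaining equations
  without leaving the integers.\<close>

lemma int_homogeneous_solution:
  fixes A :: "'i \<Rightarrow> 'j \<Rightarrow> int"
  assumes "finite I" "finite J" "card I < card J"
  shows "\<exists>x. (\<exists>j\<in>J. x j \<noteq> 0) \<and> (\<forall>i\<in>I. (\<Sum>j\<in>J. A i j * x j) = 0)"
  using assms
proof (induction I arbitrary: J A rule: finite_induct)
  case empty
  then obtain j where "j \<in> J" by fastforce
  then show ?case by (intro exI[of _ "\<lambda>_. 1"]) auto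
next
  case (insert i I)
  show ?case
  proof (cases "\<forall>j\<in>J. A i j = 0")
    case True
    have "card I < card J" using insert by simp
    from insert.IH[OF insert.prems(1) this, of A] True show ?thesis by auto
  next
    case False
    then obtain p where p: "p \<in> J" "A i p \<noteq> 0" by blast
    let ?J = "J - {p}"
    have "finite ?J" "card I < card ?J" using insert p by auto
    from insert.IH[OF this, of "\<lambda>k j. A i p * A k j - A k p * A i j"]
    obtain x where x: "\<exists>j\<in>?J. x j \<noteq> 0"
      "\<forall>k\<in>I. (\<Sum>j\<in>?J. (A i p * A k j - A k p * A i j) * x j) = 0" by blast
    \<comment> \<open>Back-substitution: scaling the other unknowns by the pivot makes the value
      forced at \<open>p\<close> integral.\<close>
    define y where "y j = (if j = p then - (\<Sum>j\<in>?J. A i j * x j) else A i p * x j)" for j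
    have sum_y: "(\<Sum>j\<in>J. A k j * y j)
        = A i p * (\<Sum>j\<in>?J. A k j * x j) - A k p * (\<Sum>j\<in>?J. A i j * x j)" for k
    proof -
      have "(\<Sum>j\<in>J. A k j * y j) = A k p * y p + (\<Sum>j\<in>?J. A k j * y j)"
        using p insert.prems(1) by (simp add: sum.remove)
      moreover have "(\<Sum>j\<in>?J. A k j * y j) = (\<Sum>j\<in>?J. A i p * (A k j * x j))"
        by (intro sum.cong) (auto simp: y_def)
      ultimately show ?thesis by (simp add: y_def sum_distrib_left)
    qed
    have "(\<Sum>j\<in>J. A k j * y j) = 0" if "k \<in> insert i I" for k
    proof (cases "k = i")
      case False
      then have "k \<in> I" using that by simp
      then have "(\<Sum>j\<in>?J. (A i p * A k j - A k p * A i j) * x j) = 0" using x by blast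
      then show ?thesis
        unfolding sum_y by (simp add: algebra_simps sum_subtractf sum_distrib_left)
    qed (simp add: sum_y)
    moreover have "\<exists>j\<in>J. y j \<noteq> 0" using x(1) p by (auto simp: y_def)
    ultimately show ?thesis by blast
  qed
qed

lemma sum_squares_eq_0D:
  fixes f :: "'a \<Rightarrow> int"
  assumes "finite I" "(\<Sum>i\<in>I. f i * f i) = 0" "i \<in> I"
  shows "f i = 0"
  using assms by (simp add: sum_nonneg_eq_0_iff)

lemma group_rank_eqI:
  assumes "\<And>B. int_independent G B \<Longrightarrow> card B \<le> m"
    and "\<exists>B. int_independent G B \<and> card B = m"
  shows "group_rank G = enat m"
  unfolding group_rank_def
proof (rule antisym)
  show "(SUP B\<in>{B. int_independent G B}. enat (card B)) \<le> enat m"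
    using assms(1) by (intro SUP_least) auto
  obtain B where "int_independent G B" "card B = m" using assms(2) by blast
  then show "enat m \<le> (SUP B\<in>{B. int_independent G B}. enat (card B))"
    by (intro SUP_upper2[of B]) auto
qed

text \<open>Additive coordinates \<open>h\<close> turn powers into multiples and products into sums,
  and \<open>inj\<close> makes them detect the unit. Multiplicative independence in the group thus
  becomes linear independence of integer vectors.\<close>

lemma int_independent_iff:
  fixes G (structure) and h :: "'g \<Rightarrow> 'i \<Rightarrow> int"
  assumes "comm_group G"
    and hom: "\<And>x y i. x \<in> carrier G \<Longrightarrow> y \<in> carrier G \<Longrightarrow> i \<in> I \<Longrightarrow> h (x \<otimes> y) i = h x i + h y i"
    and inj: "\<And>x. x \<in> carrier G \<Longrightarrow> \<forall>i\<in>I. h x i = 0 \<Longrightarrow> x = \<one>"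
  shows "int_independent G B \<longleftrightarrow> finite B \<and> B \<subseteq> carrier G \<and>
    (\<forall>c. (\<forall>i\<in>I. (\<Sum>b\<in>B. c b * h b i) = 0) \<longrightarrow> (\<forall>b\<in>B. c b = 0))"
proof -
  interpret comm_group G by fact
  have one: "h \<one> i = 0" if "i \<in> I" for i
    using hom[of \<one> \<one> i] that by simp
  have inv: "h (inv x) i = - h x i" if "x \<in> carrier G" "i \<in> I" for x i
    using hom[of x "inv x" i] that one[of i] by simp
  have npow: "h (x [^] (k::nat)) i = int k * h x i" if "x \<in> carrier G" "i \<in> I" for x k i
    using that by (induction k) (auto simp: one hom algebra_simps)
  have pow: "h (x [^] (k::int)) i = k * h x i" if "x \<in> carrier G" "i \<in> I" for x k i
  proof (cases k rule: int_cases2)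
    case (nonpos l)
    then have "h (x [^] k) i = h (inv (x [^] l)) i"
      using that by (simp add: int_pow_neg int_pow_int)
    then show ?thesis using that inv[of "x [^] l"] npow[of x i l] nonpos by simp
  qed (use that npow in \<open>simp add: int_pow_int\<close>)
  have prod: "h (\<Otimes>b\<in>B. b [^] c b) i = (\<Sum>b\<in>B. c b * h b i)"
    if "finite B" "B \<subseteq> carrier G" "i \<in> I" for c :: "'g \<Rightarrow> int" and B i
    using that
  proof (induction B rule: finite_induct)
    case (insert x B)
    then have "x \<in> carrier G" and "(\<lambda>b. b [^] c b) \<in> B \<rightarrow> carrier G" by auto
    with insert show ?case by (simp add: hom pow)
  qed (simp add: one)
  have "(\<Otimes>b\<in>B. b [^] c b) = \<one> \<longleftrightarrow> (\<forall>i\<in>I. (\<Sum>b\<in>B. c b * h b i) = 0)"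
    if B: "finite B" "B \<subseteq> carrier G" for c :: "'g \<Rightarrow> int"
  proof
    assume "(\<Otimes>b\<in>B. b [^] c b) = \<one>"
    then show "\<forall>i\<in>I. (\<Sum>b\<in>B. c b * h b i) = 0"
      using prod[OF B, of _ c] one by auto
  next
    assume *: "\<forall>i\<in>I. (\<Sum>b\<in>B. c b * h b i) = 0"
    have "(\<Otimes>b\<in>B. b [^] c b) \<in> carrier G" using B by (auto intro!: finprod_closed)
    then show "(\<Otimes>b\<in>B. b [^] c b) = \<one>"
      by (rule inj) (use * prod[OF B, of _ c] in simp)
  qed
  then show ?thesis unfolding int_independent_def by auto
qed

text \<open>
  Both bounds come from \<open>int_homogeneous_solution\<close>: vectors of the kernel and rows of the
  matrix are orthogonal, so that a relation among all of them splits into two relations, and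
  a vector orthogonal to the rows and to a set in the kernel enlarges that set.
\<close>

lemma group_rank_kernel:
  fixes G (structure) and h :: "'g \<Rightarrow> 'i \<Rightarrow> int" and A :: "'j \<Rightarrow> 'i \<Rightarrow> int"
  assumes "comm_group G" and fin: "finite I" "finite J"
    and hom: "\<And>x y i. x \<in> carrier G \<Longrightarrow> y \<in> carrier G \<Longrightarrow> i \<in> I \<Longrightarrow> h (x \<otimes> y) i = h x i + h y i"
    and inj: "\<And>x. x \<in> carrier G \<Longrightarrow> \<forall>i\<in>I. h x i = 0 \<Longrightarrow> x = \<one>"
    and ker: "\<And>x j. x \<in> carrier G \<Longrightarrow> j \<in> J \<Longrightarrow> (\<Sum>i\<in>I. A j i * h x i) = 0"
    and surj: "\<And>f. \<forall>j\<in>J. (\<Sum>i\<in>I. A j i * f i) = 0 \<Longrightarrow> \<exists>x\<in>carrier G. \<forall>i\<in>I. h x i = f i"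
    and rows: "\<And>d. \<forall>i\<in>I. (\<Sum>j\<in>J. d j * A j i) = 0 \<Longrightarrow> \<forall>j\<in>J. d j = 0"
  shows "group_rank G = enat (card I - card J)"
proof (rule group_rank_eqI)
  have indep: "int_independent G B \<longleftrightarrow> finite B \<and> B \<subseteq> carrier G \<and>
    (\<forall>c. (\<forall>i\<in>I. (\<Sum>b\<in>B. c b * h b i) = 0) \<longrightarrow> (\<forall>b\<in>B. c b = 0))" for B
    by (rule int_independent_iff) (use assms in auto)
  have indep_carrier: "finite B" "B \<subseteq> carrier G" if "int_independent G B" for B
    using that by (simp_all add: int_independent_def)
  have indepD: "c b = 0"
    if "int_independent G B" "\<And>i. i \<in> I \<Longrightarrow> (\<Sum>b\<in>B. c b * h b i) = 0" "b \<in> B" for B c b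
    using that(1)[unfolded indep] that(2,3) by blast
  show "card B \<le> card I - card J" if B: "int_independent G B" for B
  proof (rule ccontr)
    assume "\<not> ?thesis"
    \<comment> \<open>Truncation of \<open>card I - card J\<close> does no harm: the negated bound
      gives \<open>card I < card B + card J\<close> in every case.\<close>
    then have "card I < card (Sum_Type.Plus B J)" using indep_carrier[OF B] fin by (simp add: card_Plus)
    then obtain x where x: "\<exists>k\<in>(Sum_Type.Plus B J). x k \<noteq> 0"
      "\<forall>i\<in>I. (\<Sum>k\<in>(Sum_Type.Plus B J). (case k of Inl b \<Rightarrow> h b i | Inr j \<Rightarrow> A j i) * x k) = 0"
      using int_homogeneous_solution[of I "Sum_Type.Plus B J" "\<lambda>i k. case k of Inl b \<Rightarrow> h b i | Inr j \<Rightarrow> A j i"]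
        indep_carrier[OF B] fin by auto
    define v where "v i = (\<Sum>b\<in>B. x (Inl b) * h b i)" for i
    define u where "u i = (\<Sum>j\<in>J. x (Inr j) * A j i)" for i
    have vu: "u i = - v i" if "i \<in> I" for i
      using x(2)[rule_format, OF that] indep_carrier[OF B] fin
      by (simp add: sum.Plus v_def u_def mult.commute)
    have "(\<Sum>i\<in>I. A j i * v i) = 0" if "j \<in> J" for j
    proof -
      have "(\<Sum>i\<in>I. A j i * v i) = (\<Sum>b\<in>B. x (Inl b) * (\<Sum>i\<in>I. A j i * h b i))"
        unfolding v_def sum_distrib_left by (subst sum.swap) (simp add: ac_simps)
      also have "\<dots> = 0"
        using indep_carrier[OF B] ker that by (intro sum.neutral ballI) (auto simp: subset_iff)
      finally show ?thesis .
    qed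
    moreover have "(\<Sum>i\<in>I. v i * u i) = (\<Sum>j\<in>J. x (Inr j) * (\<Sum>i\<in>I. A j i * v i))"
      unfolding u_def sum_distrib_left by (subst sum.swap) (simp add: ac_simps)
    ultimately have "(\<Sum>i\<in>I. v i * u i) = 0" by simp
    then have "(\<Sum>i\<in>I. v i * v i) = 0"
      using vu by (simp add: sum_negf)
    then have v0: "v i = 0" if "i \<in> I" for i using sum_squares_eq_0D that fin by metis
    then have "\<forall>b\<in>B. x (Inl b) = 0"
      using indepD[OF B, of "\<lambda>b. x (Inl b)"] unfolding v_def by blast
    moreover have "\<forall>j\<in>J. x (Inr j) = 0"
      using v0 vu by (intro rows) (simp add: u_def)
    ultimately show False using x(1) by auto
  qed
  have "\<exists>B. int_independent G B \<and> card B = k" if "k \<le> card I - card J" for k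
    using that
  proof (induction k)
    case 0
    then show ?case by (intro exI[of _ "{}"]) (auto simp: indep)
  next
    case (Suc k)
    then obtain B where B: "int_independent G B" "card B = k" by auto
    then have "card (Sum_Type.Plus B J) < card I" using Suc.prems indep_carrier[OF B(1)] fin B(2) by (simp add: card_Plus)
    then obtain f where f: "\<exists>i\<in>I. f i \<noteq> 0"
      "\<forall>k\<in>(Sum_Type.Plus B J). (\<Sum>i\<in>I. (case k of Inl b \<Rightarrow> h b i | Inr j \<Rightarrow> A j i) * f i) = 0"
      using int_homogeneous_solution[of "Sum_Type.Plus B J" I "\<lambda>k i. case k of Inl b \<Rightarrow> h b i | Inr j \<Rightarrow> A j i"]
        indep_carrier[OF B(1)] fin by auto
    have orth: "(\<Sum>i\<in>I. h b i * f i) = 0" if "b \<in> B" for b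
      using f(2)[rule_format, of "Inl b"] that by auto
    have "(\<Sum>i\<in>I. A j i * f i) = 0" if "j \<in> J" for j
      using f(2)[rule_format, of "Inr j"] that by auto
    then obtain y where y: "y \<in> carrier G" "\<forall>i\<in>I. h y i = f i"
      using surj[of f] by blast
    have ff: "(\<Sum>i\<in>I. f i * f i) \<noteq> 0" using f(1) sum_squares_eq_0D fin by metis
    have "y \<notin> B"
    proof
      assume "y \<in> B"
      then have "(\<Sum>i\<in>I. f i * f i) = 0" using orth[of y] y by simp
      then show False using ff by simp
    qed
    moreover have "int_independent G (insert y B)"
      unfolding indep
    proof (intro conjI allI impI)
      show "finite (insert y B)" "insert y B \<subseteq> carrier G"
        using indep_carrier[OF B(1)] y by auto
      fix c assume c: "\<forall>i\<in>I. (\<Sum>b\<in>insert y B. c b * h b i) = 0"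
      have eq: "c y * f i + (\<Sum>b\<in>B. c b * h b i) = 0" if "i \<in> I" for i
        using c[rule_format, OF that] \<open>y \<notin> B\<close> indep_carrier[OF B(1)] y that by simp
      \<comment> \<open>Pairing the relation with \<open>f\<close> isolates the coefficient of
        \<open>y\<close>, because \<open>f\<close> is orthogonal to all of \<open>B\<close>.\<close>
      have "0 = (\<Sum>i\<in>I. (c y * f i + (\<Sum>b\<in>B. c b * h b i)) * f i)" using eq by simp
      also have "\<dots> = c y * (\<Sum>i\<in>I. f i * f i) + (\<Sum>b\<in>B. c b * (\<Sum>i\<in>I. h b i * f i))"
        unfolding distrib_right sum.distrib sum_distrib_left sum_distrib_right
        by (subst (2) sum.swap) (simp add: ac_simps)
      also have "\<dots> = c y * (\<Sum>i\<in>I. f i * f i)" using orth by simp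
      finally have "c y = 0" using ff by simp
      moreover from this have "\<forall>b\<in>B. c b = 0" using eq indepD[OF B(1), of c] by simp
      ultimately show "\<forall>b\<in>insert y B. c b = 0" by simp
    qed
    ultimately show ?case using B indep_carrier[OF B(1)]
      by (intro exI[of _ "insert y B"]) simp
  qed
  then show "\<exists>B. int_independent G B \<and> card B = card I - card J" by blast
qed

section \<open>The action of sl2 on sets of indices\<close>

text \<open>With \<open>f\<close> read as the coefficients of a combination of basis vectors
  \<open>e_B\<close>, this operator sends the basis vector of a set containing \<open>b\<close> but
  not \<open>a\<close> to that of the set with \<open>b\<close> replaced by \<open>a\<close>. It is
  applied to neighbouring \<open>a\<close> and \<open>b\<close> only: such a move passes no other
  index, so the exterior product contributes no sign.\<close>

definition hop :: "nat \<Rightarrow> nat \<Rightarrow> (nat set \<Rightarrow> real) \<Rightarrow> nat set \<Rightarrow> real" where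
  "hop a b f B = (if a \<in> B \<and> b \<notin> B then f (insert b (B - {a})) else 0)"

text \<open>Moves at distinct \<open>i\<close> and \<open>j\<close> share an index only when
  \<open>i\<close> and \<open>j\<close> are neighbours, and then both composites vanish.\<close>

lemma hop_commute:
  assumes "i \<noteq> j"
  shows "hop i (Suc i) (hop (Suc j) j f) B = hop (Suc j) j (hop i (Suc i) f) B"
proof -
  consider "i = Suc j" | "j = Suc i" | "i \<noteq> Suc j" "j \<noteq> Suc i" by blast
  then show ?thesis
  proof cases
    case 3
    have "insert (Suc i) (insert j (B - {Suc j}) - {i}) = insert j (insert (Suc i) (B - {i}) - {Suc j})"
      using 3 assms by auto
    then show ?thesis using 3 assms by (auto simp: hop_def insert_commute)
  qed (auto simp: hop_def)
qed

lemma hop_hop: "a \<noteq> b \<Longrightarrow> hop a b (hop b a f) B = (if a \<in> B \<and> b \<notin> B then f B else 0)"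
  by (auto simp: hop_def insert_absorb intro!: arg_cong[of _ _ f])

lemma hop_sum: "hop a b (\<lambda>B. \<Sum>i\<in>I. c i * f i B) B = (\<Sum>i\<in>I. c i * hop a b (f i) B)"
  by (cases "a \<in> B"; cases "b \<in> B") (simp_all add: hop_def)

text \<open>The solution of \<open>rung m i - rung m (i - 1) = m - 2 * i\<close> that vanishes at
  \<open>i = m\<close>: the structure constants of the irreducible sl2-module with weights
  \<open>m - 2 * i\<close>.\<close>

definition rung :: "nat \<Rightarrow> nat \<Rightarrow> real" where
  "rung m i = (real i + 1) * (real m - real i)"

definition lowering :: "nat \<Rightarrow> (nat set \<Rightarrow> real) \<Rightarrow> nat set \<Rightarrow> real" where
  "lowering m f B = (\<Sum>i<m. hop i (Suc i) f B)"

definition raising :: "nat \<Rightarrow> (nat set \<Rightarrow> real) \<Rightarrow> nat set \<Rightarrow> real" where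
  "raising m f B = (\<Sum>i<m. rung m i * hop (Suc i) i f B)"

text \<open>Summation by parts with the increments \<open>m - 2 * b\<close> of \<open>rung\<close>.
  The boundary term disappears for \<open>k = m\<close>.\<close>

lemma sum_rung_diff:
  "(\<Sum>i<k. rung m i * (u i - u (Suc i))) = (\<Sum>b\<le>k. u b * (real m - 2 * real b)) - rung m k * u k"
  by (induction k) (auto simp: rung_def algebra_simps)

text \<open>Moves at different places commute and cancel. At one place \<open>i\<close> the two
  composites test whether only \<open>i\<close>, or only \<open>Suc i\<close>, belongs to
  \<open>B\<close>; their difference is \<open>u i - u (Suc i)\<close> with the indicator
  \<open>u\<close> of \<open>B\<close>, and summation by parts yields the weight.\<close>

lemma lowering_raising_commutator:
  assumes "B \<subseteq> {..m}"
  shows "lowering m (raising m f) B - raising m (lowering m f) B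
    = (real m * real (card B) - 2 * real (\<Sum>B)) * f B"
proof -
  define u :: "nat \<Rightarrow> real" where "u i = (if i \<in> B then 1 else 0)" for i
  have EF: "lowering m (raising m f) B
      = (\<Sum>i<m. \<Sum>j<m. rung m j * hop i (Suc i) (hop (Suc j) j f) B)"
    unfolding lowering_def raising_def by (simp add: hop_sum)
  have "raising m (lowering m f) B
      = (\<Sum>j<m. \<Sum>i<m. rung m j * hop (Suc j) j (hop i (Suc i) f) B)"
    unfolding lowering_def raising_def
    using hop_sum[where c = "\<lambda>_. 1" and f = "\<lambda>i. hop i (Suc i) f"]
    by (simp add: sum_distrib_left)
  then have FE: "raising m (lowering m f) B
      = (\<Sum>i<m. \<Sum>j<m. rung m j * hop (Suc j) j (hop i (Suc i) f) B)"
    by (subst sum.swap)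
  have "lowering m (raising m f) B - raising m (lowering m f) B
      = (\<Sum>i<m. \<Sum>j<m. if j = i then rung m i * (u i - u (Suc i)) * f B else 0)"
    unfolding EF FE sum_subtractf[symmetric]
    by (intro sum.cong refl) (auto simp: hop_commute hop_hop u_def)
  also have "\<dots> = (\<Sum>i<m. rung m i * (u i - u (Suc i))) * f B"
    by (simp add: sum_distrib_right)
  also have "(\<Sum>i<m. rung m i * (u i - u (Suc i))) = (\<Sum>b\<le>m. u b * (real m - 2 * real b))"
    unfolding sum_rung_diff by (simp add: rung_def)
  also have "\<dots> = (\<Sum>b\<in>B. real m - 2 * real b)"
    using assms by (intro sum.mono_neutral_cong_right) (auto simp: u_def)
  also have "\<dots> = real m * real (card B) - 2 * real (\<Sum>B)"
    by (simp add: sum_subtractf sum_distrib_left)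
  finally show ?thesis .
qed

text \<open>The weights for which \<^const>\<open>raising\<close> is the adjoint of \<^const>\<open>lowering\<close>.\<close>

definition rung_weight :: "nat \<Rightarrow> nat set \<Rightarrow> real" where
  "rung_weight m B = (\<Prod>a\<in>B. \<Prod>b\<in>{a..<m}. rung m b)"

lemma rung_weight_pos: "B \<subseteq> {..m} \<Longrightarrow> 0 < rung_weight m B"
  unfolding rung_weight_def rung_def by (intro prod_pos) auto

lemma rung_weight_hop:
  assumes "finite B" "i \<in> B" "Suc i \<notin> B" "i < m"
  shows "rung_weight m B = rung m i * rung_weight m (insert (Suc i) (B - {i}))"
proof -
  have "(\<Prod>b\<in>{i..<m}. rung m b) = rung m i * (\<Prod>b\<in>{Suc i..<m}. rung m b)"
    using assms(4) by (rule prod.atLeast_Suc_lessThan)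
  then show ?thesis
    using assms by (simp add: rung_weight_def prod.remove[of B i])
qed

text \<open>Replacing \<open>i\<close> by \<open>Suc i\<close> matches the sets containing only
  \<open>i\<close> of the two with those containing only \<open>Suc i\<close>. Matched sets have
  weights in the ratio \<open>rung m i\<close>, which is exactly the coefficient that
  \<open>raising\<close> attaches to the reverse move.\<close>

lemma hop_adjoint:
  assumes "i < m"
  shows "(\<Sum>B\<in>Pow {..m}. rung_weight m B * g B * hop i (Suc i) f B)
    = (\<Sum>A\<in>Pow {..m}. rung_weight m A * (rung m i * hop (Suc i) i g A) * f A)"
proof -
  let ?L = "{B \<in> Pow {..m}. i \<in> B \<and> Suc i \<notin> B}" and ?R = "{A \<in> Pow {..m}. Suc i \<in> A \<and> i \<notin> A}"
  have "(\<Sum>B\<in>Pow {..m}. rung_weight m B * g B * hop i (Suc i) f B)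
      = (\<Sum>B\<in>?L. rung_weight m B * g B * f (insert (Suc i) (B - {i})))"
    by (intro sum.mono_neutral_cong_right) (auto simp: hop_def)
  also have "\<dots> = (\<Sum>A\<in>?R. rung_weight m A * (rung m i * g (insert i (A - {Suc i}))) * f A)"
  proof (rule sum.reindex_bij_witness[where
        i = "\<lambda>A. insert i (A - {Suc i})" and j = "\<lambda>B. insert (Suc i) (B - {i})"])
    fix B assume B: "B \<in> ?L"
    then have "finite B" by (auto intro: finite_subset)
    moreover have "insert i (insert (Suc i) (B - {i}) - {Suc i}) = B" using B by auto
    ultimately show "rung_weight m (insert (Suc i) (B - {i})) *
        (rung m i * g (insert i (insert (Suc i) (B - {i}) - {Suc i}))) * f (insert (Suc i) (B - {i}))
      = rung_weight m B * g B * f (insert (Suc i) (B - {i}))"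
      using rung_weight_hop[of B i m] B assms by simp
  qed (use assms in auto)
  also have "\<dots> = (\<Sum>A\<in>Pow {..m}. rung_weight m A * (rung m i * hop (Suc i) i g A) * f A)"
    by (intro sum.mono_neutral_cong_left) (auto simp: hop_def)
  finally show ?thesis .
qed

lemma lowering_adjoint:
  "(\<Sum>B\<in>Pow {..m}. rung_weight m B * g B * lowering m f B)
    = (\<Sum>B\<in>Pow {..m}. rung_weight m B * raising m g B * f B)"
proof -
  have "(\<Sum>B\<in>Pow {..m}. rung_weight m B * g B * lowering m f B)
      = (\<Sum>i<m. \<Sum>B\<in>Pow {..m}. rung_weight m B * g B * hop i (Suc i) f B)"
    unfolding lowering_def sum_distrib_left by (rule sum.swap)
  also have "\<dots> = (\<Sum>i<m. \<Sum>B\<in>Pow {..m}. rung_weight m B * (rung m i * hop (Suc i) i g B) * f B)"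
    by (simp add: hop_adjoint)
  also have "\<dots> = (\<Sum>B\<in>Pow {..m}. rung_weight m B * raising m g B * f B)"
    unfolding raising_def sum_distrib_left sum_distrib_right by (rule sum.swap)
  finally show ?thesis .
qed

section \<open>Injectivity from positivity\<close>

text \<open>By adjointness the two squared norms are the pairings of \<open>f\<close> with
  \<open>EF f\<close> and \<open>FE f\<close>, so they differ by the pairing with the commutator.
  Its eigenvalue depends on \<open>B\<close> and therefore stays inside the sum, which leaves
  \<open>f\<close> free to mix degrees and sizes.\<close>

lemma raising_lowering_norm:
  "(\<Sum>B\<in>Pow {..m}. rung_weight m B * (raising m f B)\<^sup>2)
    = (\<Sum>B\<in>Pow {..m}. rung_weight m B * (lowering m f B)\<^sup>2)
    + (\<Sum>B\<in>Pow {..m}. rung_weight m B * (real m * real (card B) - 2 * real (\<Sum>B)) * (f B)\<^sup>2)"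
proof -
  have F: "(\<Sum>B\<in>Pow {..m}. rung_weight m B * (raising m f B)\<^sup>2)
      = (\<Sum>B\<in>Pow {..m}. rung_weight m B * f B * lowering m (raising m f) B)"
    unfolding lowering_adjoint by (simp add: power2_eq_square mult.assoc)
  have E: "(\<Sum>B\<in>Pow {..m}. rung_weight m B * (lowering m f B)\<^sup>2)
      = (\<Sum>B\<in>Pow {..m}. rung_weight m B * f B * raising m (lowering m f) B)"
    using lowering_adjoint[of m "lowering m f" f] by (simp add: power2_eq_square ac_simps)
  have "(\<Sum>B\<in>Pow {..m}. rung_weight m B * f B * lowering m (raising m f) B)
      - (\<Sum>B\<in>Pow {..m}. rung_weight m B * f B * raising m (lowering m f) B)
    = (\<Sum>B\<in>Pow {..m}. rung_weight m B * f B
        * (lowering m (raising m f) B - raising m (lowering m f) B))"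
    by (simp add: sum_subtractf right_diff_distrib)
  also have "\<dots> = (\<Sum>B\<in>Pow {..m}.
      rung_weight m B * (real m * real (card B) - 2 * real (\<Sum>B)) * (f B)\<^sup>2)"
    by (intro sum.cong refl) (simp add: lowering_raising_commutator power2_eq_square ac_simps)
  finally show ?thesis unfolding F E by simp
qed

text \<open>The weights are controlled only on the support of \<open>f\<close>, since the eigenvalue
  of the commutator has a known sign only there.\<close>

lemma weighted_sum_squares_pos:
  assumes "finite S" "\<And>B. B \<in> S \<Longrightarrow> f B \<noteq> 0 \<Longrightarrow> 0 < w B" "B \<in> S" "f B \<noteq> 0"
  shows "0 < (\<Sum>B\<in>S. w B * (f B)\<^sup>2 :: real)"
proof (rule sum_pos2[OF assms(1,3)])
  show "0 < w B * (f B)\<^sup>2" using assms by simp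
  show "0 \<le> w C * (f C)\<^sup>2" if "C \<in> S" for C
    using assms(2)[OF that] by (cases "f C = 0") (auto intro!: mult_nonneg_nonneg less_imp_le)
qed

text \<open>If \<open>E f = 0\<close>, the norm identity equates the nonnegative norm of
  \<open>F f\<close> with a sum whose coefficients are negative on the support of
  \<open>f\<close>.\<close>

lemma lowering_injective:
  assumes supp: "\<And>B. B \<subseteq> {..m} \<Longrightarrow> f B \<noteq> 0 \<Longrightarrow> m * card B < 2 * \<Sum>B"
    and zero: "\<And>B. B \<subseteq> {..m} \<Longrightarrow> lowering m f B = 0"
    and B: "B \<subseteq> {..m}"
  shows "f B = 0"
proof (rule ccontr)
  assume "f B \<noteq> 0"
  have pos: "0 < rung_weight m C * (2 * real (\<Sum>C) - real m * real (card C))"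
    if "C \<in> Pow {..m}" "f C \<noteq> 0" for C
  proof -
    have "real (m * card C) < real (2 * \<Sum>C)" using supp that by (subst of_nat_less_iff) auto
    then show ?thesis using that rung_weight_pos[of C m] by simp
  qed
  have "0 < (\<Sum>B\<in>Pow {..m}. rung_weight m B * (2 * real (\<Sum>B) - real m * real (card B)) * (f B)\<^sup>2)"
    by (rule weighted_sum_squares_pos[where B = B]) (use pos B \<open>f B \<noteq> 0\<close> in auto)
  also have "\<dots> = - (\<Sum>B\<in>Pow {..m}. rung_weight m B * (real m * real (card B) - 2 * real (\<Sum>B)) * (f B)\<^sup>2)"
    unfolding sum_negf[symmetric] by (intro sum.cong refl) (simp add: algebra_simps)
  also have "\<dots> = - (\<Sum>B\<in>Pow {..m}. rung_weight m B * (raising m f B)\<^sup>2)"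
    unfolding raising_lowering_norm using zero by simp
  also have "\<dots> \<le> 0"
    unfolding neg_le_0_iff_le
    by (intro sum_nonneg mult_nonneg_nonneg zero_le_power2 less_imp_le[OF rung_weight_pos]) simp
  finally show False by simp
qed

text \<open>If \<open>F f = 0\<close>, the norm identity makes the norm of \<open>E f\<close> and a
  sum with positive coefficients on the support of \<open>f\<close> add up to zero.\<close>

lemma raising_injective:
  assumes supp: "\<And>B. B \<subseteq> {..m} \<Longrightarrow> f B \<noteq> 0 \<Longrightarrow> 2 * \<Sum>B < m * card B"
    and zero: "\<And>B. B \<subseteq> {..m} \<Longrightarrow> raising m f B = 0"
    and B: "B \<subseteq> {..m}"
  shows "f B = 0"
proof (rule ccontr)
  assume "f B \<noteq> 0"
  have pos: "0 < rung_weight m C * (real m * real (card C) - 2 * real (\<Sum>C))"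
    if "C \<in> Pow {..m}" "f C \<noteq> 0" for C
  proof -
    have "real (2 * \<Sum>C) < real (m * card C)" using supp that by (subst of_nat_less_iff) auto
    then show ?thesis using that rung_weight_pos[of C m] by simp
  qed
  have "0 < (\<Sum>B\<in>Pow {..m}. rung_weight m B * (real m * real (card B) - 2 * real (\<Sum>B)) * (f B)\<^sup>2)"
    by (rule weighted_sum_squares_pos[where B = B]) (use pos B \<open>f B \<noteq> 0\<close> in auto)
  also have "\<dots> = - (\<Sum>B\<in>Pow {..m}. rung_weight m B * (lowering m f B)\<^sup>2)"
    using raising_lowering_norm[of m f] zero by simp
  also have "\<dots> \<le> 0"
    unfolding neg_le_0_iff_le
    by (intro sum_nonneg mult_nonneg_nonneg zero_le_power2 less_imp_le[OF rung_weight_pos]) simp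
  finally show False by simp
qed

text \<open>The plain transpose of \<open>E\<close> lacks the factors \<open>rung m i\<close>.
  Dividing by \<open>rung_weight\<close> conjugates it into \<open>raising\<close>, so the
  injectivity of \<open>raising\<close> carries over.\<close>

lemma hop_transpose_injective:
  assumes supp: "\<And>B. B \<subseteq> {..m} \<Longrightarrow> f B \<noteq> 0 \<Longrightarrow> 2 * \<Sum>B < m * card B"
    and zero: "\<And>B. B \<subseteq> {..m} \<Longrightarrow> (\<Sum>i<m. hop (Suc i) i f B) = 0"
    and B: "B \<subseteq> {..m}"
  shows "f B = 0"
proof -
  have "raising m (\<lambda>B. f B / rung_weight m B) A = (\<Sum>i<m. hop (Suc i) i f A) / rung_weight m A"
    if A: "A \<subseteq> {..m}" for A
    unfolding raising_def sum_divide_distrib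
  proof (intro sum.cong refl)
    fix i assume i: "i \<in> {..<m}"
    show "rung m i * hop (Suc i) i (\<lambda>B. f B / rung_weight m B) A = hop (Suc i) i f A / rung_weight m A"
    proof (cases "Suc i \<in> A \<and> i \<notin> A")
      case True
      let ?B = "insert i (A - {Suc i})"
      have "finite ?B" using A by (auto intro: finite_subset)
      moreover have "insert (Suc i) (?B - {i}) = A" using True by auto
      ultimately have "rung_weight m ?B = rung m i * rung_weight m A"
        using rung_weight_hop[of ?B i m] i by simp
      then show ?thesis using True i by (simp add: hop_def rung_def)
    qed (auto simp: hop_def)
  qed
  then have "f B / rung_weight m B = 0"
    using supp zero B by (intro raising_injective[of m "\<lambda>B. f B / rung_weight m B"]) auto
  then show ?thesis using rung_weight_pos[OF B] by simp
qed

section \<open>Exterior powers in coordinates\<close>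

lemma wedge_relations_cases [consumes 1, case_names add smult alt]:
  assumes "x \<in> wedge_relations n r"
  obtains vs i v w where "x = frag_of (vs[i := v + w]) - frag_of (vs[i := v]) - frag_of (vs[i := w])"
      "vs \<in> vec_tuples n r" "i < r" "v \<in> carrier_vec n" "w \<in> carrier_vec n"
  | vs i c v where "x = frag_of (vs[i := c \<cdot>\<^sub>v v]) - frag_cmul c (frag_of (vs[i := v]))"
      "vs \<in> vec_tuples n r" "i < r" "v \<in> carrier_vec n"
  | vs i j where "x = frag_of vs" "vs \<in> vec_tuples n r" "i < j" "j < r" "vs ! i = vs ! j"
  using assms unfolding wedge_relations_def by blast

lemma vec_tuples_update:
  "vs \<in> vec_tuples n r \<Longrightarrow> v \<in> carrier_vec n \<Longrightarrow> vs[i := v] \<in> vec_tuples n r"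
  unfolding vec_tuples_def using set_update_subset_insert[of vs i v] by auto

lemma vec_tuples_nth: "vs \<in> vec_tuples n r \<Longrightarrow> i < r \<Longrightarrow> vs ! i \<in> carrier_vec n"
  unfolding vec_tuples_def by auto

lemma keys_wedge_relations:
  assumes "x \<in> wedge_relations n r"
  shows "Poly_Mapping.keys x \<subseteq> vec_tuples n r"
  using assms
proof (cases rule: wedge_relations_cases)
  case (add vs i v w)
  then show ?thesis
    using keys_diff[of "frag_of (vs[i := v + w]) - frag_of (vs[i := v])" "frag_of (vs[i := w])"]
      keys_diff[of "frag_of (vs[i := v + w])" "frag_of (vs[i := v])"]
      vec_tuples_update[OF add(2), of "v + w" i] vec_tuples_update[OF add(2), of v i]
      vec_tuples_update[OF add(2), of w i]
    by auto
next
  case (smult vs i c v)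
  then show ?thesis
    using keys_diff[of "frag_of (vs[i := c \<cdot>\<^sub>v v])" "frag_cmul c (frag_of (vs[i := v]))"]
      vec_tuples_update[OF smult(2), of "c \<cdot>\<^sub>v v" i] vec_tuples_update[OF smult(2), of v i]
    by (auto split: if_splits)
qed auto

lemma subgroup_wedge_null: "subgroup (wedge_null n r) (free_Abelian_group (vec_tuples n r))"
  unfolding wedge_null_def
  by (rule group.generate_is_subgroup) (use keys_wedge_relations in auto)

lemma keys_wedge_null: "x \<in> wedge_null n r \<Longrightarrow> Poly_Mapping.keys x \<subseteq> vec_tuples n r"
  using subgroup.mem_carrier[OF subgroup_wedge_null] by fastforce

lemma wedge_null_zero: "0 \<in> wedge_null n r"
  using subgroup.one_closed[OF subgroup_wedge_null] by simp

lemma wedge_null_add: "x \<in> wedge_null n r \<Longrightarrow> y \<in> wedge_null n r \<Longrightarrow> x + y \<in> wedge_null n r"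
  using subgroup.m_closed[OF subgroup_wedge_null] by simp

lemma wedge_null_minus: "x \<in> wedge_null n r \<Longrightarrow> - x \<in> wedge_null n r"
  using subgroup.m_inv_closed[OF subgroup_wedge_null, of x] keys_wedge_null[of x] by simp

lemma wedge_null_diff: "x \<in> wedge_null n r \<Longrightarrow> y \<in> wedge_null n r \<Longrightarrow> x - y \<in> wedge_null n r"
  using wedge_null_add[of x n r "- y"] wedge_null_minus[of y] by simp

text \<open>Closure under differences covers both rules of \<open>generate\<close>: an inverse is
  \<open>0 - h\<close>, and a sum is \<open>h1 - (0 - h2)\<close>.\<close>

lemma wedge_null_induct [consumes 1, case_names zero rel diff]:
  assumes "x \<in> wedge_null n r" and "P 0" and "\<And>x. x \<in> wedge_relations n r \<Longrightarrow> P x"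
    and diff: "\<And>x y. P x \<Longrightarrow> P y \<Longrightarrow> P (x - y)"
  shows "P x"
  using assms(1) unfolding wedge_null_def
proof (induction rule: generate.induct)
  case (inv h)
  then show ?case using diff[OF assms(2), of h] assms(3) keys_wedge_relations by auto
next
  case (eng h1 h2)
  then show ?case using diff[of h1 "0 - h2"] diff[OF assms(2), of h2] by simp
qed (use assms in auto)

lemma wedge_null_relation: "x \<in> wedge_relations n r \<Longrightarrow> x \<in> wedge_null n r"
  unfolding wedge_null_def by (rule generate.incl)

lemma wedge_null_addition:
  assumes "vs \<in> vec_tuples n r" "i < r" "v \<in> carrier_vec n" "w \<in> carrier_vec n"
  shows "frag_of (vs[i := v + w]) - frag_of (vs[i := v]) - frag_of (vs[i := w]) \<in> wedge_null n r"
  by (rule wedge_null_relation) (use assms in \<open>unfold wedge_relations_def, blast\<close>)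

lemma wedge_null_smult:
  assumes "vs \<in> vec_tuples n r" "i < r" "v \<in> carrier_vec n"
  shows "frag_of (vs[i := c \<cdot>\<^sub>v v]) - frag_cmul c (frag_of (vs[i := v])) \<in> wedge_null n r"
  by (rule wedge_null_relation) (use assms in \<open>unfold wedge_relations_def, blast\<close>)

lemma wedge_null_repeated:
  assumes "vs \<in> vec_tuples n r" "i < j" "j < r" "vs ! i = vs ! j"
  shows "frag_of vs \<in> wedge_null n r"
  by (rule wedge_null_relation) (use assms in \<open>unfold wedge_relations_def, blast\<close>)

text \<open>Polarization: putting \<open>v + w\<close> into both slots gives a null element, and
  additivity in each slot leaves only the two mixed terms.\<close>

lemma wedge_null_swap:
  assumes vs: "vs \<in> vec_tuples n r" and ij: "i < j" "j < r"
    and v: "v \<in> carrier_vec n" and w: "w \<in> carrier_vec n"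
  shows "frag_of (vs[i := v, j := w]) + frag_of (vs[i := w, j := v]) \<in> wedge_null n r"
proof -
  define f where "f x y = frag_of (vs[i := x, j := y])" for x y
  have len: "length vs = r" using vs by (simp add: vec_tuples_def)
  have rep: "f x x \<in> wedge_null n r" if "x \<in> carrier_vec n" for x
    unfolding f_def
    by (rule wedge_null_repeated[of _ n r i j])
      (use that vs ij len in \<open>auto intro!: vec_tuples_update simp: nth_list_update\<close>)
  have left: "f (v + w) y - f v y - f w y \<in> wedge_null n r" if "y \<in> carrier_vec n" for y
    using wedge_null_addition[OF vec_tuples_update[OF vs that, of j], of i v w] ij v w
    by (simp add: f_def list_update_swap)
  have right: "f x (v + w) - f x v - f x w \<in> wedge_null n r" if "x \<in> carrier_vec n" for x
    using wedge_null_addition[OF vec_tuples_update[OF vs that, of i], of j v w] ij v w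
    by (simp add: f_def)
  have "f v w + f w v = f (v + w) (v + w) - (f (v + w) (v + w) - f v (v + w) - f w (v + w))
      - (f v (v + w) - f v v - f v w) - (f w (v + w) - f w v - f w w) - f v v - f w w"
    by (simp add: algebra_simps)
  also have "\<dots> \<in> wedge_null n r"
    using v w by (intro wedge_null_diff rep left right) auto
  finally show ?thesis unfolding f_def .
qed

text \<open>The lift of \<open>ext_power_map\<close> to representatives in the free group.\<close>

definition wedge_map :: "int mat \<Rightarrow> (int vec list \<Rightarrow>\<^sub>0 int) \<Rightarrow> int vec list \<Rightarrow>\<^sub>0 int" where
  "wedge_map T = frag_extend (\<lambda>vs. frag_of (map (\<lambda>v. T *\<^sub>v v) vs))"

lemma vec_tuples_map:
  "T \<in> carrier_mat n n \<Longrightarrow> vs \<in> vec_tuples n r \<Longrightarrow> map (\<lambda>v. T *\<^sub>v v) vs \<in> vec_tuples n r"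
  unfolding vec_tuples_def by auto

lemma keys_wedge_map:
  assumes "T \<in> carrier_mat n n" "Poly_Mapping.keys x \<subseteq> vec_tuples n r"
  shows "Poly_Mapping.keys (wedge_map T x) \<subseteq> vec_tuples n r"
  unfolding wedge_map_def
  by (rule order_trans[OF keys_frag_extend]) (use assms vec_tuples_map in auto)

text \<open>Each kind of relation is sent to a relation of the same kind, so the map descends to the
  quotient.\<close>

lemma wedge_map_null:
  assumes T: "T \<in> carrier_mat n n" and "x \<in> wedge_null n r"
  shows "wedge_map T x \<in> wedge_null n r"
  using assms(2)
proof (induction rule: wedge_null_induct)
  case (rel x)
  then show ?case
  proof (cases rule: wedge_relations_cases)
    case (add vs i v w)
    then show ?thesis
      using wedge_null_addition[OF vec_tuples_map[OF T add(2)] add(3), of "T *\<^sub>v v" "T *\<^sub>v w"] T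
      by (simp add: wedge_map_def frag_extend_diff map_update mult_add_distrib_mat_vec)
  next
    case (smult vs i c v)
    have "T *\<^sub>v (c \<cdot>\<^sub>v v) = c \<cdot>\<^sub>v (T *\<^sub>v v)"
      using T smult(4) by (intro eq_vecI) auto
    then show ?thesis
      using smult wedge_null_smult[OF vec_tuples_map[OF T smult(2)] smult(3), of "T *\<^sub>v v" c] T
      by (simp add: wedge_map_def frag_extend_diff frag_extend_cmul map_update)
  next
    case (alt vs i j)
    then show ?thesis
      using wedge_null_repeated[OF vec_tuples_map[OF T alt(2)] alt(3,4)]
      by (simp add: wedge_map_def vec_tuples_def)
  qed
qed (simp_all add: wedge_map_def wedge_null_zero wedge_null_diff frag_extend_diff)

section \<open>Minors as coordinates\<close>

definition index_sets :: "nat \<Rightarrow> nat \<Rightarrow> nat set set" where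
  "index_sets n r = {A. A \<subseteq> {..<n} \<and> card A = r}"

lemma finite_index_sets [simp]: "finite (index_sets n r)"
  unfolding index_sets_def by (rule finite_subset[of _ "Pow {..<n}"]) auto

lemma index_sets_nth:
  assumes "A \<in> index_sets n r" "i < r"
  shows "sorted_list_of_set A ! i < n"
proof -
  have "finite A" using assms by (auto simp: index_sets_def intro: finite_subset)
  then have "sorted_list_of_set A ! i \<in> A"
    using assms by (metis (mono_tags, lifting) index_sets_def length_sorted_list_of_set mem_Collect_eq
        nth_mem set_sorted_list_of_set)
  then show ?thesis using assms by (auto simp: index_sets_def)
qed

text \<open>The Pluecker coordinate at \<open>A\<close>: the coefficient of the basis vector of
  \<open>A\<close> in the exterior product of \<open>vs\<close>. The vectors form the rows, the
  elements of \<open>A\<close> in increasing order select the columns.\<close>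

definition minor :: "int vec list \<Rightarrow> nat set \<Rightarrow> int" where
  "minor vs A = det (mat (length vs) (length vs) (\<lambda>(i, j). vs ! i $ (sorted_list_of_set A ! j)))"

text \<open>The Leibniz formula with the factor from row \<open>i\<close> split off, so that
  linearity in \<open>v\<close> can be checked term by term.\<close>

lemma minor_update:
  assumes "i < length vs"
  shows "minor (vs[i := v]) A = (\<Sum>p | p permutes {0..<length vs}. signof p *
    (v $ (sorted_list_of_set A ! p i) * (\<Prod>k\<in>{0..<length vs} - {i}. vs ! k $ (sorted_list_of_set A ! p k))))"
proof -
  let ?r = "length vs" and ?l = "sorted_list_of_set A"
  have "(\<Prod>k = 0..<?r. vs[i := v] ! k $ (?l ! p k))
      = v $ (?l ! p i) * (\<Prod>k\<in>{0..<?r} - {i}. vs ! k $ (?l ! p k))" for p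
    using assms by (subst prod.remove[of _ i]) auto
  moreover have "minor (vs[i := v]) A
      = (\<Sum>p | p permutes {0..<?r}. signof p * (\<Prod>k = 0..<?r. vs[i := v] ! k $ (?l ! p k)))"
    unfolding minor_def
    by (subst det_def'[of _ ?r])
      (auto intro!: sum.cong prod.cong simp: permutes_in_image[of _ "{0..<?r}", simplified])
  ultimately show ?thesis by simp
qed

lemma minor_add:
  assumes "i < length vs" "v \<in> carrier_vec n" "w \<in> carrier_vec n" "A \<in> index_sets n (length vs)"
  shows "minor (vs[i := v + w]) A = minor (vs[i := v]) A + minor (vs[i := w]) A"
  unfolding minor_update[OF assms(1)] sum.distrib[symmetric]
proof (intro sum.cong refl)
  fix p assume "p \<in> {p. p permutes {0..<length vs}}"
  then have "p i < length vs" using assms(1) permutes_in_image[of p "{0..<length vs}" i] by simp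
  then have "sorted_list_of_set A ! p i < n" using index_sets_nth assms(4) by blast
  then show "signof p * ((v + w) $ (sorted_list_of_set A ! p i) *
      (\<Prod>k\<in>{0..<length vs} - {i}. vs ! k $ (sorted_list_of_set A ! p k))) =
    signof p * (v $ (sorted_list_of_set A ! p i) *
      (\<Prod>k\<in>{0..<length vs} - {i}. vs ! k $ (sorted_list_of_set A ! p k))) +
    signof p * (w $ (sorted_list_of_set A ! p i) *
      (\<Prod>k\<in>{0..<length vs} - {i}. vs ! k $ (sorted_list_of_set A ! p k)))"
    using assms(2,3) by (simp add: distrib_left distrib_right)
qed

lemma minor_smult:
  assumes "i < length vs" "v \<in> carrier_vec n" "A \<in> index_sets n (length vs)"
  shows "minor (vs[i := c \<cdot>\<^sub>v v]) A = c * minor (vs[i := v]) A"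
  unfolding minor_update[OF assms(1)] sum_distrib_left
proof (intro sum.cong refl)
  fix p assume "p \<in> {p. p permutes {0..<length vs}}"
  then have "p i < length vs" using assms(1) permutes_in_image[of p "{0..<length vs}" i] by simp
  then have "sorted_list_of_set A ! p i < n" using index_sets_nth assms(3) by blast
  then show "signof p * ((c \<cdot>\<^sub>v v) $ (sorted_list_of_set A ! p i) *
      (\<Prod>k\<in>{0..<length vs} - {i}. vs ! k $ (sorted_list_of_set A ! p k))) =
    c * (signof p * (v $ (sorted_list_of_set A ! p i) *
      (\<Prod>k\<in>{0..<length vs} - {i}. vs ! k $ (sorted_list_of_set A ! p k))))"
    using assms(2) by simp
qed

lemma minor_repeated:
  assumes "i < j" "j < length vs" "vs ! i = vs ! j"
  shows "minor vs A = 0"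
  unfolding minor_def
  by (rule det_identical_rows[of _ "length vs" i j])
    (use assms in \<open>auto intro!: eq_vecI\<close>)

text \<open>The candidate for the isomorphism from the exterior power to the free group on
  \<open>index_sets n r\<close>, still defined on representatives.\<close>

definition wedge_coords :: "nat \<Rightarrow> nat \<Rightarrow> (int vec list \<Rightarrow>\<^sub>0 int) \<Rightarrow> nat set \<Rightarrow>\<^sub>0 int" where
  "wedge_coords n r = frag_extend (\<lambda>vs. \<Sum>A\<in>index_sets n r. frag_cmul (minor vs A) (frag_of A))"

lemma lookup_wedge_coords_frag_of:
  "Poly_Mapping.lookup (wedge_coords n r (frag_of vs)) A = (if A \<in> index_sets n r then minor vs A else 0)"
proof -
  have "Poly_Mapping.lookup (wedge_coords n r (frag_of vs)) A
      = (\<Sum>B\<in>index_sets n r. if B = A then minor vs B else 0)"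
    unfolding wedge_coords_def frag_extend_of Poly_Mapping.lookup_sum by (intro sum.cong) auto
  then show ?thesis by simp
qed

lemma keys_wedge_coords: "Poly_Mapping.keys (wedge_coords n r x) \<subseteq> index_sets n r"
  unfolding wedge_coords_def
  by (rule order_trans[OF keys_frag_extend])
    (auto dest!: subsetD[OF keys_sum] split: if_splits)

lemma wedge_coords_diff: "wedge_coords n r (x - y) = wedge_coords n r x - wedge_coords n r y"
  by (simp add: wedge_coords_def frag_extend_diff)

lemma wedge_coords_add: "wedge_coords n r (x + y) = wedge_coords n r x + wedge_coords n r y"
  by (simp add: wedge_coords_def frag_extend_add)

text \<open>Minors are additive and homogeneous in each row and vanish on repeated rows, which are
  the three kinds of relations. Hence the coordinates depend only on the class.\<close>

lemma wedge_coords_null: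
  assumes "x \<in> wedge_null n r"
  shows "wedge_coords n r x = 0"
  using assms
proof (induction rule: wedge_null_induct)
  case (rel x)
  have len: "length vs = r" if "vs \<in> vec_tuples n r" for vs
    using that by (simp add: vec_tuples_def)
  from rel show ?case
  proof (cases rule: wedge_relations_cases)
    case (add vs i v w)
    then show ?thesis
      using minor_add[of i vs v n w] len[OF add(2)]
      by (intro poly_mapping_eqI)
        (simp add: wedge_coords_diff lookup_minus lookup_wedge_coords_frag_of)
  next
    case (smult vs i c v)
    have "wedge_coords n r (frag_cmul c y) = frag_cmul c (wedge_coords n r y)" for y
      by (simp add: wedge_coords_def frag_extend_cmul)
    then show ?thesis
      using smult minor_smult[of i vs v n] len[OF smult(2)]
      by (intro poly_mapping_eqI)
        (simp add: wedge_coords_diff lookup_minus lookup_wedge_coords_frag_of)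
  next
    case (alt vs i j)
    then show ?thesis
      using minor_repeated[of i j vs] len[OF alt(2)]
      by (intro poly_mapping_eqI) (simp add: lookup_wedge_coords_frag_of)
  qed
qed (simp_all add: wedge_coords_diff, simp add: wedge_coords_def)

text \<open>
  If the entry of \<open>T\<close> at \<open>(x, y)\<close> vanishes unless \<open>y \<in> {x - 1, x}\<close>, only the identity
  permutation contributes to a minor: a contributing permutation is increasing.
\<close>

lemma det_lower_bidiagonal_minor:
  fixes T :: "nat \<Rightarrow> nat \<Rightarrow> int"
  assumes a: "sorted_wrt (<) a" "length a = r" and b: "sorted_wrt (<) b" "length b = r"
    and T: "\<And>x y. T x y \<noteq> 0 \<Longrightarrow> x = y \<or> x = Suc y"
  shows "det (mat r r (\<lambda>(i, j). T (a ! i) (b ! j))) = (\<Prod>i<r. T (a ! i) (b ! i))"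
proof -
  have "(\<Prod>i = 0..<r. T (a ! i) (b ! p i)) = 0" if p: "p permutes {0..<r}" and "p \<noteq> id" for p
  proof (rule ccontr)
    assume "\<not> ?thesis"
    then have nz: "a ! i = b ! p i \<or> a ! i = Suc (b ! p i)" if "i < r" for i
      using T that by (auto simp: prod_zero_iff)
    have lt: "p i < r" if "i < r" for i using permutes_in_image[OF p, of i] that by simp
    have "p i < p j" if ij: "i < j" "j < r" for i j
    proof -
      have "a ! i < a ! j" using sorted_wrt_nth_less[OF a(1)] ij a(2) by simp
      \<comment> \<open>\<open>b ! p i\<close> is at most \<open>a ! i\<close>, which is at most
        \<open>a ! j - 1\<close>, which is at most \<open>b ! p j\<close>.\<close>
      then have "b ! p i \<le> b ! p j" using nz[of i] nz[of j] ij by auto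
      moreover have "p i \<noteq> p j" using permutes_inj[OF p] ij by (auto dest: injD)
      moreover have "b ! p j < b ! p i" if "p j < p i"
        using sorted_wrt_nth_less[OF b(1) that] lt ij b(2) by simp
      ultimately show ?thesis by (metis leD linorder_neqE_nat)
    qed
    then have mono: "strict_mono_on {..<r} p" by (auto simp: strict_mono_on_def)
    have ge: "i \<le> p i" if "i < r" for i
      using that
    proof (induction i)
      case (Suc i)
      then have "p i < p (Suc i)" using mono by (auto simp: strict_mono_on_def)
      then show ?case using Suc by simp
    qed simp
    have "p i = i" if "i < r" for i
    proof -
      have "p ` {0..<r} = {0..<r}" using p by (rule permutes_image)
      \<comment> \<open>A permutation preserves the sum of all indices, so the nonnegative gaps
        \<open>p i - i\<close> add up to 0.\<close>
      then have "(\<Sum>i\<in>{0..<r}. p i) = \<Sum>{0..<r}"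
        using permutes_inj_on[OF p, of "{0..<r}"] by (metis (no_types, lifting) sum.cong sum.reindex_cong)
      then have "(\<Sum>i\<in>{0..<r}. p i - i) = 0"
        using ge by (subst sum_subtractf_nat) auto
      then have "p i - i = 0" using that by (subst (asm) sum_eq_0_iff) auto
      then show ?thesis using ge[OF that] by simp
    qed
    then have "p = id" using p by (auto simp: permutes_def fun_eq_iff)
    then show False using \<open>p \<noteq> id\<close> by simp
  qed
  note other = this
  have "det (mat r r (\<lambda>(i, j). T (a ! i) (b ! j)))
      = (\<Sum>p | p permutes {0..<r}. signof p * (\<Prod>i = 0..<r. T (a ! i) (b ! p i)))"
    by (subst det_def'[of _ r])
      (auto intro!: sum.cong prod.cong simp: permutes_in_image[of _ "{0..<r}", simplified])
  also have "\<dots> = (\<Sum>p\<in>{id}. signof p * (\<Prod>i = 0..<r. T (a ! i) (b ! p i)))"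
    by (intro sum.mono_neutral_right) (auto simp: finite_permutations permutes_id other)
  also have "\<dots> = (\<Prod>i<r. T (a ! i) (b ! i))"
    by (simp add: sign_id atLeast0LessThan)
  finally show ?thesis .
qed

definition basis_tuple :: "nat \<Rightarrow> nat set \<Rightarrow> int vec list" where
  "basis_tuple n A = map (unit_vec n) (sorted_list_of_set A)"

definition basis_combination :: "nat \<Rightarrow> (nat set \<Rightarrow>\<^sub>0 int) \<Rightarrow> int vec list \<Rightarrow>\<^sub>0 int" where
  "basis_combination n = frag_extend (\<lambda>A. frag_of (basis_tuple n A))"

lemma basis_combination_diff:
  "basis_combination n (x - y) = basis_combination n x - basis_combination n y"
  by (simp add: basis_combination_def frag_extend_diff)

lemma index_sets_sorted_list:
  assumes "A \<in> index_sets n r"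
  shows "sorted_wrt (<) (sorted_list_of_set A)" "length (sorted_list_of_set A) = r"
    "set (sorted_list_of_set A) = A" "finite A"
proof -
  show "finite A" using assms by (auto simp: index_sets_def intro: finite_subset)
  then show "sorted_wrt (<) (sorted_list_of_set A)" "length (sorted_list_of_set A) = r"
    "set (sorted_list_of_set A) = A"
    using assms by (auto simp: index_sets_def)
qed

lemma basis_tuple_in: "A \<in> index_sets n r \<Longrightarrow> basis_tuple n A \<in> vec_tuples n r"
  using index_sets_sorted_list[of A n r]
  by (auto simp: basis_tuple_def vec_tuples_def)

lemma keys_basis_combination:
  "Poly_Mapping.keys y \<subseteq> index_sets n r \<Longrightarrow>
    Poly_Mapping.keys (basis_combination n y) \<subseteq> vec_tuples n r"
  unfolding basis_combination_def
  by (rule order_trans[OF keys_frag_extend]) (use basis_tuple_in in auto)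

text \<open>Serves two matrices \<open>T\<close>: the identity, which yields the duality of basis
  tuples and minors, and the bidiagonal matrix of the shift.\<close>

lemma minor_map_matrix:
  assumes A: "A \<in> index_sets n r" and B: "B \<in> index_sets n r"
    and f: "\<And>x y. x < n \<Longrightarrow> y < n \<Longrightarrow> f x $ y = T x y"
    and T: "\<And>x y. T x y \<noteq> 0 \<Longrightarrow> x = y \<or> x = Suc y"
  shows "minor (map f (sorted_list_of_set A)) B
    = (\<Prod>i<r. T (sorted_list_of_set A ! i) (sorted_list_of_set B ! i))"
proof -
  note a = index_sets_sorted_list[OF A] and b = index_sets_sorted_list[OF B]
  have "minor (map f (sorted_list_of_set A)) B
      = det (mat r r (\<lambda>(i, j). T (sorted_list_of_set A ! i) (sorted_list_of_set B ! j)))"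
    unfolding minor_def length_map a(2)
    by (rule arg_cong[of _ _ det], rule cong_mat)
      (use f index_sets_nth[OF A] index_sets_nth[OF B] a(2) in auto)
  also have "\<dots> = (\<Prod>i<r. T (sorted_list_of_set A ! i) (sorted_list_of_set B ! i))"
    by (rule det_lower_bidiagonal_minor) (use a b T in auto)
  finally show ?thesis .
qed

lemma minor_basis_tuple:
  assumes A: "A \<in> index_sets n r" and B: "B \<in> index_sets n r"
  shows "minor (basis_tuple n A) B = (if A = B then 1 else 0)"
proof -
  have *: "minor (basis_tuple n A) B
      = (\<Prod>i<r. if sorted_list_of_set A ! i = sorted_list_of_set B ! i then 1 else 0)"
    unfolding basis_tuple_def
    by (rule minor_map_matrix[OF A B, where T = "\<lambda>x y. if x = y then 1 else 0"])
      (auto split: if_splits)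
  show ?thesis
  proof (cases "A = B")
    case False
    then have "sorted_list_of_set A \<noteq> sorted_list_of_set B"
      using index_sets_sorted_list(3)[OF A] index_sets_sorted_list(3)[OF B] by metis
    then obtain i where "i < r" "sorted_list_of_set A ! i \<noteq> sorted_list_of_set B ! i"
      using index_sets_sorted_list(2)[OF A] index_sets_sorted_list(2)[OF B]
      by (metis nth_equalityI)
    then show ?thesis using False unfolding * by (auto intro!: prod_zero)
  qed (use * in simp)
qed

text \<open>Basis tuples and minors are dual, so the coordinates recover the coefficients. This is
  the independence of the basis classes.\<close>

lemma wedge_coords_basis_combination:
  assumes "Poly_Mapping.keys y \<subseteq> index_sets n r"
  shows "wedge_coords n r (basis_combination n y) = y"
  using assms
proof (induction y rule: frag_induction)
  case (one A)
  then show ?case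
    by (intro poly_mapping_eqI)
      (auto simp: basis_combination_def lookup_wedge_coords_frag_of minor_basis_tuple)
qed (simp_all add: basis_combination_diff wedge_coords_diff,
    simp add: basis_combination_def wedge_coords_def)

section \<open>Spanning by increasing tuples of unit vectors\<close>

definition wedge_spanned :: "nat \<Rightarrow> nat \<Rightarrow> (int vec list \<Rightarrow>\<^sub>0 int) \<Rightarrow> bool" where
  "wedge_spanned n r x \<longleftrightarrow>
    (\<exists>y. Poly_Mapping.keys y \<subseteq> index_sets n r \<and> x - basis_combination n y \<in> wedge_null n r)"

lemma wedge_spanned_null: "x \<in> wedge_null n r \<Longrightarrow> wedge_spanned n r x"
  unfolding wedge_spanned_def by (rule exI[of _ 0]) (simp add: basis_combination_def)

lemma wedge_spanned_diff:
  assumes "wedge_spanned n r x" "wedge_spanned n r y"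
  shows "wedge_spanned n r (x - y)"
proof -
  obtain u v where u: "Poly_Mapping.keys u \<subseteq> index_sets n r" "x - basis_combination n u \<in> wedge_null n r"
    and v: "Poly_Mapping.keys v \<subseteq> index_sets n r" "y - basis_combination n v \<in> wedge_null n r"
    using assms unfolding wedge_spanned_def by blast
  have "x - y - basis_combination n (u - v)
      = (x - basis_combination n u) - (y - basis_combination n v)"
    by (simp add: basis_combination_diff)
  also have "\<dots> \<in> wedge_null n r" using u v wedge_null_diff by blast
  finally show ?thesis
    unfolding wedge_spanned_def using u(1) v(1) keys_diff[of u v] by blast
qed

lemma wedge_spanned_add:
  assumes "wedge_spanned n r x" "wedge_spanned n r y"
  shows "wedge_spanned n r (x + y)"
proof -
  have "wedge_spanned n r (x - (0 - y))"
    by (intro wedge_spanned_diff assms wedge_spanned_null wedge_null_zero)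
  then show ?thesis by simp
qed

lemma wedge_spanned_cmul: "wedge_spanned n r x \<Longrightarrow> wedge_spanned n r (frag_cmul c x)"
  by (rule frag_closure_minus_cmul)
    (auto intro: wedge_spanned_null wedge_null_zero wedge_spanned_diff)

lemma wedge_spanned_cong:
  assumes "x - y \<in> wedge_null n r" "wedge_spanned n r y"
  shows "wedge_spanned n r x"
  using wedge_spanned_add[OF wedge_spanned_null[OF assms(1)] assms(2)] by simp

lemma not_sorted_wrt_less_split:
  "\<not> sorted_wrt (<) xs \<Longrightarrow> \<exists>us a b vs. xs = us @ a # b # vs \<and> \<not> a < (b :: 'a :: linorder)"
proof (induction xs)
  case (Cons x xs)
  show ?case
  proof (cases "sorted_wrt (<) xs")
    case True
    then obtain b vs where xs: "xs = b # vs" "\<not> x < b"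
      using Cons.prems by (cases xs) (auto dest: order.strict_trans)
    then show ?thesis by (intro exI[of _ "[]"]) auto
  next
    case False
    then obtain us a b vs where "xs = us @ a # b # vs" "\<not> a < b" using Cons.IH by blast
    then show ?thesis by (intro exI[of _ "x # us"]) auto
  qed
qed simp

text \<open>Bubble sort: exchanging an adjacent descent changes the sign modulo the relations and
  lowers the list lexicographically, while an adjacent equality makes the tuple null. Strictly
  increasing lists are the basis tuples.\<close>

lemma wedge_spanned_unit_vecs:
  assumes "length xs = r" "set xs \<subseteq> {..<n}"
  shows "wedge_spanned n r (frag_of (map (unit_vec n) xs))"
  using wf_lex[OF wf_less_than] assms
proof (induction xs rule: wf_induct_rule)
  case (less xs)
  show ?case
  proof (cases "sorted_wrt (<) xs")
    case True
    then have xs: "sorted_list_of_set (set xs) = xs" "distinct xs"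
      by (auto simp: strict_sorted_iff sorted_list_of_set_sort_remdups distinct_remdups_id sorted_sort_id)
    then have "set xs \<in> index_sets n r"
      using less.prems by (auto simp: index_sets_def distinct_card)
    then show ?thesis
      unfolding wedge_spanned_def
      by (intro exI[of _ "frag_of (set xs)"])
        (simp add: basis_combination_def basis_tuple_def xs wedge_null_zero)
  next
    case False
    then obtain us a b vs where xs: "xs = us @ a # b # vs" "\<not> a < b"
      using not_sorted_wrt_less_split by blast
    let ?t = "map (unit_vec n) xs :: int vec list"
    let ?i = "length us"
    have t: "?t \<in> vec_tuples n r" using less.prems by (auto simp: vec_tuples_def)
    have i: "?i < Suc ?i" "Suc ?i < r" using less.prems xs by auto
    show ?thesis
    proof (cases "a = b")
      case True
      then show ?thesis
        by (intro wedge_spanned_null wedge_null_repeated[OF t i]) (simp add: xs nth_append)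
    next
      case False
      let ?ys = "us @ b # a # vs"
      have "(?ys, xs) \<in> lex less_than"
        using xs False unfolding lex_conv by (auto intro!: exI[of _ us])
      then have ys: "wedge_spanned n r (frag_of (map (unit_vec n) ?ys))"
        using less.prems xs by (intro less.IH) auto
      have "frag_of ?t + frag_of (map (unit_vec n) ?ys) \<in> wedge_null n r"
        using wedge_null_swap[OF t i, of "unit_vec n a" "unit_vec n b"]
        by (simp add: xs list_update_append)
      then have "wedge_spanned n r (frag_of ?t + frag_of (map (unit_vec n) ?ys))"
        by (rule wedge_spanned_null)
      from wedge_spanned_diff[OF this ys] show ?thesis by simp
    qed
  qed
qed

text \<open>The vector is built up from its truncations \<open>u m\<close>, one coordinate at a
  time. The alternative \<open>c = 0\<close> in the scaling rule provides the zero vector as a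
  start, even in dimension 0, where there are no unit vectors.\<close>

lemma carrier_vec_induct [consumes 1, case_names unit add smult]:
  fixes v :: "'a :: comm_ring_1 vec"
  assumes v: "v \<in> carrier_vec n"
    and unit: "\<And>i. i < n \<Longrightarrow> P (unit_vec n i)"
    and add: "\<And>v w. v \<in> carrier_vec n \<Longrightarrow> w \<in> carrier_vec n \<Longrightarrow> P v \<Longrightarrow> P w \<Longrightarrow> P (v + w)"
    and smult: "\<And>c v. v \<in> carrier_vec n \<Longrightarrow> P v \<or> c = 0 \<Longrightarrow> P (c \<cdot>\<^sub>v v)"
  shows "P v"
proof -
  define u where "u m = vec n (\<lambda>i. if i < m then v $ i else 0)" for m
  have "P (u m)" if "m \<le> n" for m
    using that
  proof (induction m)
    case 0
    have "u 0 = 0 \<cdot>\<^sub>v v" using v by (intro eq_vecI) (auto simp: u_def)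
    then show ?case using smult[OF v, of 0] by simp
  next
    case (Suc m)
    have "u (Suc m) = u m + v $ m \<cdot>\<^sub>v unit_vec n m"
      using Suc.prems by (intro eq_vecI) (auto simp: u_def unit_vec_def less_Suc_eq)
    moreover have "P (v $ m \<cdot>\<^sub>v unit_vec n m)" using Suc.prems unit smult by simp
    ultimately show ?case using Suc by (auto intro!: add simp: u_def)
  qed
  moreover have "u n = v" using v by (intro eq_vecI) (auto simp: u_def)
  ultimately show ?thesis by (metis order_refl)
qed

text \<open>\<open>k\<close> bounds the slots not yet known to hold unit vectors. Multilinearity in
  slot \<open>k\<close> reduces an arbitrary entry to unit vectors, which lowers the bound by
  one.\<close>

lemma wedge_spanned_tuple:
  assumes "vs \<in> vec_tuples n r" "\<And>i. k \<le> i \<Longrightarrow> i < r \<Longrightarrow> \<exists>a<n. vs ! i = unit_vec n a"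
  shows "wedge_spanned n r (frag_of vs)"
  using assms
proof (induction k arbitrary: vs)
  case 0
  then obtain a where a: "\<And>i. i < r \<Longrightarrow> a i < n \<and> vs ! i = unit_vec n (a i)" by (metis le0)
  then have "vs = map (unit_vec n) (map a [0..<r])"
    using 0(1) by (intro nth_equalityI) (auto simp: vec_tuples_def)
  then show ?case using wedge_spanned_unit_vecs[of "map a [0..<r]" r n] a by fastforce
next
  case (Suc k)
  show ?case
  proof (cases "k < r")
    case k: True
    have len: "length vs = r" using Suc.prems by (simp add: vec_tuples_def)
    have "wedge_spanned n r (frag_of (vs[k := v]))" if "v \<in> carrier_vec n" for v
      using that
    proof (induction v rule: carrier_vec_induct)
      case (unit i)
      show ?case
      proof (rule Suc.IH)
        show "vs[k := unit_vec n i] \<in> vec_tuples n r"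
          by (rule vec_tuples_update) (use Suc.prems in auto)
        show "\<exists>a<n. vs[k := unit_vec n i] ! j = unit_vec n a" if "k \<le> j" "j < r" for j
          using that unit Suc.prems(2)[of j] len by (cases "j = k") auto
      qed
    next
      case (add v w)
      have "frag_of (vs[k := v + w]) - (frag_of (vs[k := v]) + frag_of (vs[k := w])) \<in> wedge_null n r"
        using wedge_null_addition[OF Suc.prems(1) k add(1,2)] by (simp add: algebra_simps)
      then show ?case by (rule wedge_spanned_cong) (intro wedge_spanned_add add)
    next
      case (smult c v)
      have "wedge_spanned n r (frag_cmul c (frag_of (vs[k := v])))"
        using smult(2) wedge_spanned_null[OF wedge_null_zero]
        by (cases "c = 0") (auto intro: wedge_spanned_cmul)
      then show ?case
        by (rule wedge_spanned_cong[OF wedge_null_smult[OF Suc.prems(1) k smult(1)]])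
    qed
    from this[OF vec_tuples_nth[OF Suc.prems(1) k]] show ?thesis by simp
  qed (use Suc in auto)
qed

lemma wedge_spanned_all:
  assumes "Poly_Mapping.keys x \<subseteq> vec_tuples n r"
  shows "wedge_spanned n r x"
  using assms
proof (induction x rule: frag_induction)
  case (one vs)
  then show ?case using wedge_spanned_tuple[of vs n r r] by auto
qed (auto intro: wedge_spanned_null wedge_null_zero wedge_spanned_diff)

text \<open>Spanning provides some coefficients \<open>y\<close>. Since the coordinates kill null
  elements and invert \<open>basis_combination\<close>, these coefficients must be the
  coordinates.\<close>

lemma wedge_coords_expansion:
  assumes "Poly_Mapping.keys x \<subseteq> vec_tuples n r"
  shows "x - basis_combination n (wedge_coords n r x) \<in> wedge_null n r"
proof -
  obtain y where y: "Poly_Mapping.keys y \<subseteq> index_sets n r" "x - basis_combination n y \<in> wedge_null n r"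
    using wedge_spanned_all[OF assms] unfolding wedge_spanned_def by blast
  have "wedge_coords n r x = y"
    using wedge_coords_null[OF y(2)] wedge_coords_basis_combination[OF y(1)]
    by (simp add: wedge_coords_diff)
  then show ?thesis using y(2) by simp
qed

lemma wedge_null_iff_coords:
  assumes "Poly_Mapping.keys x \<subseteq> vec_tuples n r"
  shows "x \<in> wedge_null n r \<longleftrightarrow> wedge_coords n r x = 0"
  using wedge_coords_null wedge_coords_expansion[OF assms] by (auto simp: basis_combination_def)

section \<open>The fixed subgroup\<close>

lemma wedge_map_add: "wedge_map T (x + y) = wedge_map T x + wedge_map T y"
  by (simp add: wedge_map_def frag_extend_add)

lemma wedge_map_diff: "wedge_map T (x - y) = wedge_map T x - wedge_map T y"
  by (simp add: wedge_map_def frag_extend_diff)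

lemma wedge_map_minus: "wedge_map T (- x) = - wedge_map T x"
  by (simp add: wedge_map_def frag_extend_minus)

definition wedge_class :: "nat \<Rightarrow> nat \<Rightarrow> (int vec list \<Rightarrow>\<^sub>0 int) \<Rightarrow> (int vec list \<Rightarrow>\<^sub>0 int) set" where
  "wedge_class n r x = wedge_null n r #>\<^bsub>free_Abelian_group (vec_tuples n r)\<^esub> x"

lemma mem_wedge_class: "z \<in> wedge_class n r x \<longleftrightarrow> z - x \<in> wedge_null n r"
proof
  assume "z - x \<in> wedge_null n r"
  then show "z \<in> wedge_class n r x"
    unfolding wedge_class_def r_coset_def by (auto intro!: bexI[of _ "z - x"])
qed (auto simp: wedge_class_def r_coset_def)

lemma wedge_class_eq_iff: "wedge_class n r x = wedge_class n r y \<longleftrightarrow> x - y \<in> wedge_null n r"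
proof
  assume "wedge_class n r x = wedge_class n r y"
  moreover have "x \<in> wedge_class n r x" by (simp add: mem_wedge_class wedge_null_zero)
  ultimately show "x - y \<in> wedge_null n r" by (simp add: mem_wedge_class)
next
  assume xy: "x - y \<in> wedge_null n r"
  show "wedge_class n r x = wedge_class n r y"
  proof (intro equalityI subsetI)
    fix z assume "z \<in> wedge_class n r x"
    then show "z \<in> wedge_class n r y"
      using wedge_null_add[OF _ xy, of "z - x"] by (simp add: mem_wedge_class)
  next
    fix z assume "z \<in> wedge_class n r y"
    then show "z \<in> wedge_class n r x"
      using wedge_null_diff[OF _ xy, of "z - y"] by (simp add: mem_wedge_class)
  qed
qed

lemma comm_group_ext_power: "comm_group (ext_power n r)"
  unfolding ext_power_def
  by (rule comm_group.abelian_FactGroup[OF abelian_free_Abelian_group subgroup_wedge_null])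

lemma normal_wedge_null: "wedge_null n r \<lhd> free_Abelian_group (vec_tuples n r)"
  by (rule comm_group.subgroup_imp_normal[OF abelian_free_Abelian_group subgroup_wedge_null])

lemma carrier_ext_power:
  "carrier (ext_power n r) = wedge_class n r ` {x. Poly_Mapping.keys x \<subseteq> vec_tuples n r}"
proof -
  have "carrier (free_Abelian_group (vec_tuples n r)) = {x. Poly_Mapping.keys x \<subseteq> vec_tuples n r}"
    by auto
  then show ?thesis by (simp add: ext_power_def carrier_FactGroup wedge_class_def)
qed

lemma wedge_class_mult:
  assumes "Poly_Mapping.keys x \<subseteq> vec_tuples n r" "Poly_Mapping.keys y \<subseteq> vec_tuples n r"
  shows "wedge_class n r x \<otimes>\<^bsub>ext_power n r\<^esub> wedge_class n r y = wedge_class n r (x + y)"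
  using normal.rcos_sum[OF normal_wedge_null, of x n r y] assms
  by (simp add: ext_power_def wedge_class_def)

lemma wedge_class_zero: "wedge_class n r 0 = \<one>\<^bsub>ext_power n r\<^esub>"
  by (auto simp: ext_power_def mem_wedge_class)

lemma wedge_class_inv:
  assumes "Poly_Mapping.keys x \<subseteq> vec_tuples n r"
  shows "inv\<^bsub>ext_power n r\<^esub> wedge_class n r x = wedge_class n r (- x)"
  by (rule group.inv_equality[OF comm_group.axioms(2)[OF comm_group_ext_power]])
    (use assms in \<open>auto simp: wedge_class_mult wedge_class_zero carrier_ext_power\<close>)

lemma ext_power_map_wedge_class:
  assumes "T \<in> carrier_mat n n"
  shows "ext_power_map n r T (wedge_class n r x) = wedge_class n r (wedge_map T x)"
proof -
  have "wedge_class n r (wedge_map T z) = wedge_class n r (wedge_map T x)"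
    if "z \<in> wedge_class n r x" for z
    using wedge_map_null[OF assms, of "z - x" r] that
    by (simp add: wedge_class_eq_iff mem_wedge_class wedge_map_diff)
  moreover have "x \<in> wedge_class n r x" by (simp add: mem_wedge_class wedge_null_zero)
  ultimately show ?thesis
    unfolding ext_power_map_def wedge_class_def[symmetric] wedge_map_def[symmetric] by blast
qed

lemma S_mat_carrier: "S_mat n \<in> carrier_mat n n"
  by (simp add: S_mat_def)

lemma carrier_fixed_part:
  "carrier (fixed_part n r) = wedge_class n r `
    {x. Poly_Mapping.keys x \<subseteq> vec_tuples n r \<and> wedge_map (S_mat n) x - x \<in> wedge_null n r}"
proof -
  have "ext_power_map n r (S_mat n) (wedge_class n r x) \<otimes>\<^bsub>ext_power n r\<^esub>
      inv\<^bsub>ext_power n r\<^esub> wedge_class n r x = \<one>\<^bsub>ext_power n r\<^esub>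
    \<longleftrightarrow> wedge_map (S_mat n) x - x \<in> wedge_null n r"
    if "Poly_Mapping.keys x \<subseteq> vec_tuples n r" for x
    using that keys_wedge_map[OF S_mat_carrier that] wedge_class_eq_iff[of n r _ 0]
    by (simp add: ext_power_map_wedge_class[OF S_mat_carrier] wedge_class_inv wedge_class_mult
        wedge_class_zero[symmetric])
  then show ?thesis
    unfolding fixed_part_def kernel_def by (auto simp: carrier_ext_power)
qed

lemma comm_group_fixed_part: "comm_group (fixed_part n r)"
proof -
  interpret comm_group "ext_power n r" by (rule comm_group_ext_power)
  have sub: "carrier (fixed_part n r) \<subseteq> carrier (ext_power n r)"
    by (auto simp: carrier_fixed_part carrier_ext_power)
  have "subgroup (carrier (fixed_part n r)) (ext_power n r)"
  proof (rule subgroup.intro[OF sub])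
    show "\<one>\<^bsub>ext_power n r\<^esub> \<in> carrier (fixed_part n r)"
      unfolding carrier_fixed_part wedge_class_zero[symmetric]
      by (rule imageI) (simp add: wedge_map_def wedge_null_zero)
    fix X assume "X \<in> carrier (fixed_part n r)"
    then obtain x where x: "X = wedge_class n r x" "Poly_Mapping.keys x \<subseteq> vec_tuples n r"
      "wedge_map (S_mat n) x - x \<in> wedge_null n r" by (auto simp: carrier_fixed_part)
    have "wedge_map (S_mat n) (- x) - (- x) \<in> wedge_null n r"
      using wedge_null_minus[OF x(3)] by (simp add: wedge_map_minus)
    then show "inv\<^bsub>ext_power n r\<^esub> X \<in> carrier (fixed_part n r)"
      using x by (auto simp: carrier_fixed_part wedge_class_inv)
    fix Y assume "Y \<in> carrier (fixed_part n r)"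
    then obtain y where y: "Y = wedge_class n r y" "Poly_Mapping.keys y \<subseteq> vec_tuples n r"
      "wedge_map (S_mat n) y - y \<in> wedge_null n r" by (auto simp: carrier_fixed_part)
    have "wedge_map (S_mat n) (x + y) - (x + y) \<in> wedge_null n r"
      using wedge_null_add[OF x(3) y(3)] by (simp add: wedge_map_add algebra_simps)
    moreover have "Poly_Mapping.keys (x + y) \<subseteq> vec_tuples n r"
      using x(2) y(2) Poly_Mapping.keys_add[of x y] by blast
    ultimately show "X \<otimes>\<^bsub>ext_power n r\<^esub> Y \<in> carrier (fixed_part n r)"
      using x y by (auto simp: carrier_fixed_part wedge_class_mult)
  qed
  then have "group (ext_power n r\<lparr>carrier := carrier (fixed_part n r)\<rparr>)"
    by (rule subgroup.subgroup_is_group) (rule is_group)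
  moreover have "ext_power n r\<lparr>carrier := carrier (fixed_part n r)\<rparr> = fixed_part n r"
    by (simp add: fixed_part_def)
  ultimately have grp: "group (fixed_part n r)" by simp
  show ?thesis
  proof (rule group.group_comm_groupI[OF grp])
    fix X Y assume "X \<in> carrier (fixed_part n r)" "Y \<in> carrier (fixed_part n r)"
    then have "X \<otimes>\<^bsub>ext_power n r\<^esub> Y = Y \<otimes>\<^bsub>ext_power n r\<^esub> X" using m_comm sub by blast
    then show "X \<otimes>\<^bsub>fixed_part n r\<^esub> Y = Y \<otimes>\<^bsub>fixed_part n r\<^esub> X"
      by (simp add: fixed_part_def)
  qed
qed

text \<open>Group elements are cosets, so a representative is chosen. Any two representatives differ
  by a null element, whose coordinates vanish.\<close>

definition class_coord :: "nat \<Rightarrow> nat \<Rightarrow> (int vec list \<Rightarrow>\<^sub>0 int) set \<Rightarrow> nat set \<Rightarrow> int" where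
  "class_coord n r X = Poly_Mapping.lookup (wedge_coords n r (SOME x. x \<in> X))"

lemma class_coord_wedge_class:
  "class_coord n r (wedge_class n r x) = Poly_Mapping.lookup (wedge_coords n r x)"
proof -
  have "x \<in> wedge_class n r x" by (simp add: mem_wedge_class wedge_null_zero)
  then have "(SOME z. z \<in> wedge_class n r x) \<in> wedge_class n r x" by (rule someI)
  then have "wedge_coords n r (SOME z. z \<in> wedge_class n r x) - wedge_coords n r x = 0"
    using wedge_coords_null by (simp add: mem_wedge_class flip: wedge_coords_diff)
  then show ?thesis by (simp add: class_coord_def)
qed

section \<open>The matrix of the exterior power of the shift\<close>

text \<open>For index sets of equal size this is the coefficient of the basis vector of
  \<open>B\<close> in the image of that of \<open>A\<close>. It is 1 exactly when the sorted list of
  \<open>B\<close> arises from that of \<open>A\<close> by lowering some entries by one in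
  place.\<close>

definition shift_minor :: "nat set \<Rightarrow> nat set \<Rightarrow> int" where
  "shift_minor A B = (\<Prod>i<card A. if sorted_list_of_set A ! i = sorted_list_of_set B ! i
      \<or> sorted_list_of_set A ! i = Suc (sorted_list_of_set B ! i) then 1 else 0)"

lemma lookup_wedge_coords_outside:
  assumes "B \<notin> index_sets n r"
  shows "Poly_Mapping.lookup (wedge_coords n r x) B = 0"
proof -
  have "B \<notin> Poly_Mapping.keys (wedge_coords n r x)" using assms keys_wedge_coords by blast
  then show ?thesis by (simp add: in_keys_iff)
qed

text \<open>The rows of the minor are the images of unit vectors, that is, columns of
  \<open>S_mat\<close>. This transposition turns the superdiagonal into the condition
  \<open>x = Suc y\<close> and makes the bidiagonal formula applicable.\<close>

lemma minor_S_mat: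
  assumes A: "A \<in> index_sets n r" and B: "B \<in> index_sets n r"
  shows "minor (map (\<lambda>v. S_mat n *\<^sub>v v) (basis_tuple n A)) B = shift_minor A B"
proof -
  have "card A = r" using A by (simp add: index_sets_def)
  have entry: "(S_mat n *\<^sub>v unit_vec n x) $ y = (if x = y \<or> x = Suc y then 1 else 0)"
    if "x < n" "y < n" for x y
  proof -
    have "(S_mat n *\<^sub>v unit_vec n x) $ y = row (S_mat n) y \<bullet> unit_vec n x"
      using that by (simp add: S_mat_def)
    also have "\<dots> = row (S_mat n) y $ x"
      using that S_mat_carrier by (intro scalar_prod_right_unit) auto
    also have "\<dots> = (if x = y \<or> x = Suc y then 1 else 0)"
      using that by (simp add: S_mat_def)
    finally show ?thesis .
  qed
  have "minor (map (\<lambda>x. S_mat n *\<^sub>v unit_vec n x) (sorted_list_of_set A)) B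
      = (\<Prod>i<r. if sorted_list_of_set A ! i = sorted_list_of_set B ! i
          \<or> sorted_list_of_set A ! i = Suc (sorted_list_of_set B ! i) then 1 else 0)"
  proof (rule minor_map_matrix[OF A B, where T = "\<lambda>x y. if x = y \<or> x = Suc y then 1 else 0"])
    show "x = y \<or> x = Suc y" if "(if x = y \<or> x = Suc y then 1 else 0 :: int) \<noteq> 0" for x y :: nat
      using that by presburger
  qed (rule entry)
  then show ?thesis
    by (simp add: shift_minor_def basis_tuple_def o_def \<open>card A = r\<close>)
qed

text \<open>Modulo null elements, which the map preserves, \<open>x\<close> is the basis combination
  of its own coordinates; on basis combinations the formula is additive and known on
  generators.\<close>

lemma lookup_wedge_coords_map:
  assumes x: "Poly_Mapping.keys x \<subseteq> vec_tuples n r" and B: "B \<in> index_sets n r"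
  shows "Poly_Mapping.lookup (wedge_coords n r (wedge_map (S_mat n) x)) B
    = (\<Sum>A\<in>index_sets n r. Poly_Mapping.lookup (wedge_coords n r x) A * shift_minor A B)"
proof -
  have basis: "Poly_Mapping.lookup (wedge_coords n r (wedge_map (S_mat n) (basis_combination n y))) B
      = (\<Sum>A\<in>index_sets n r. Poly_Mapping.lookup y A * shift_minor A B)"
    if "Poly_Mapping.keys y \<subseteq> index_sets n r" for y
    using that
  proof (induction y rule: frag_induction)
    case zero
    then show ?case by (simp add: basis_combination_def wedge_map_def wedge_coords_def)
  next
    case (one A)
    have "(\<Sum>C\<in>index_sets n r. Poly_Mapping.lookup (frag_of A) C * shift_minor C B)
        = (\<Sum>C\<in>index_sets n r. if C = A then shift_minor C B else 0)"
      by (intro sum.cong) auto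
    then show ?case
      using one B
      by (simp add: basis_combination_def wedge_map_def lookup_wedge_coords_frag_of minor_S_mat)
  next
    case (diff u v)
    then show ?case
      by (simp add: basis_combination_diff wedge_map_diff wedge_coords_diff
          Poly_Mapping.lookup_minus left_diff_distrib sum_subtractf)
  qed
  let ?y = "wedge_coords n r x"
  have "wedge_coords n r (wedge_map (S_mat n) (x - basis_combination n ?y)) = 0"
    by (intro wedge_coords_null wedge_map_null[OF S_mat_carrier] wedge_coords_expansion x)
  then have "wedge_coords n r (wedge_map (S_mat n) x)
      = wedge_coords n r (wedge_map (S_mat n) (basis_combination n ?y))"
    by (simp add: wedge_map_diff wedge_coords_diff)
  then show ?thesis using basis[OF keys_wedge_coords] by simp
qed

lemma wedge_map_fixed_iff:
  assumes x: "Poly_Mapping.keys x \<subseteq> vec_tuples n r"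
  shows "wedge_map (S_mat n) x - x \<in> wedge_null n r \<longleftrightarrow> (\<forall>B\<in>index_sets n r.
    (\<Sum>A\<in>index_sets n r. Poly_Mapping.lookup (wedge_coords n r x) A * shift_minor A B)
      = Poly_Mapping.lookup (wedge_coords n r x) B)"
proof -
  have "Poly_Mapping.keys (wedge_map (S_mat n) x - x) \<subseteq> vec_tuples n r"
    using keys_diff[of "wedge_map (S_mat n) x" x] keys_wedge_map[OF S_mat_carrier x] x by blast
  then have "wedge_map (S_mat n) x - x \<in> wedge_null n r
      \<longleftrightarrow> wedge_coords n r (wedge_map (S_mat n) x) = wedge_coords n r x"
    by (simp add: wedge_null_iff_coords wedge_coords_diff)
  also have "\<dots> \<longleftrightarrow> (\<forall>B\<in>index_sets n r. Poly_Mapping.lookup (wedge_coords n r (wedge_map (S_mat n) x)) B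
      = Poly_Mapping.lookup (wedge_coords n r x) B)"
  proof
    assume *: "\<forall>B\<in>index_sets n r. Poly_Mapping.lookup (wedge_coords n r (wedge_map (S_mat n) x)) B
      = Poly_Mapping.lookup (wedge_coords n r x) B"
    show "wedge_coords n r (wedge_map (S_mat n) x) = wedge_coords n r x"
    proof (rule poly_mapping_eqI)
      fix B
      show "Poly_Mapping.lookup (wedge_coords n r (wedge_map (S_mat n) x)) B
          = Poly_Mapping.lookup (wedge_coords n r x) B"
        using * lookup_wedge_coords_outside[of B n r] by (cases "B \<in> index_sets n r") auto
    qed
  qed simp
  finally show ?thesis using lookup_wedge_coords_map[OF x] by simp
qed

section \<open>The leading term of the shift\<close>

lemma sum_index_set:
  assumes "A \<in> index_sets n r"
  shows "\<Sum>A = (\<Sum>i<r. sorted_list_of_set A ! i)"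
proof -
  note a = index_sets_sorted_list[OF assms]
  have "\<Sum>A = sum_list (sorted_list_of_set A)"
    using a sum_list_distinct_conv_sum_set[of "sorted_list_of_set A" "\<lambda>x. x"] by simp
  then show ?thesis using a(2) by (simp add: sum_list_sum_nth atLeast0LessThan)
qed

lemma shift_minor_refl: "shift_minor A A = 1"
  by (simp add: shift_minor_def)

lemma shift_minor_cases: "shift_minor A B = 0 \<or> shift_minor A B = 1"
  unfolding shift_minor_def by (induction rule: infinite_finite_induct[where A = "{..<card A}"]) auto

lemma shift_minor_nonzero_iff:
  assumes "A \<in> index_sets n r"
  shows "shift_minor A B \<noteq> 0 \<longleftrightarrow> (\<forall>i<r. sorted_list_of_set A ! i = sorted_list_of_set B ! i
    \<or> sorted_list_of_set A ! i = Suc (sorted_list_of_set B ! i))"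
  using assms by (auto simp: shift_minor_def index_sets_def)

text \<open>Unitriangularity with respect to the degree: a nonzero entry makes the sorted list of
  \<open>A\<close> dominate that of \<open>B\<close> termwise, so failure to drop in the sum forces
  equality.\<close>

lemma shift_minor_nonzeroD:
  assumes A: "A \<in> index_sets n r" and B: "B \<in> index_sets n r" and "shift_minor A B \<noteq> 0"
  shows "A = B \<or> \<Sum>B < \<Sum>A"
proof (rule disjCI)
  note a = index_sets_sorted_list[OF A] and b = index_sets_sorted_list[OF B]
  have step: "sorted_list_of_set A ! i = sorted_list_of_set B ! i
      \<or> sorted_list_of_set A ! i = Suc (sorted_list_of_set B ! i)" if "i < r" for i
    using assms(3) that by (simp add: shift_minor_nonzero_iff[OF A])
  then have le: "sorted_list_of_set B ! i \<le> sorted_list_of_set A ! i" if "i < r" for i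
    using that by force
  assume "\<not> \<Sum>B < \<Sum>A"
  then have "(\<Sum>i<r. sorted_list_of_set A ! i - sorted_list_of_set B ! i) = 0"
    using le by (subst sum_subtractf_nat) (auto simp: sum_index_set[OF A] sum_index_set[OF B])
  then have "sorted_list_of_set A ! i - sorted_list_of_set B ! i = 0" if "i < r" for i
    using that by simp
  then have "sorted_list_of_set A = sorted_list_of_set B"
    using le a(2) b(2) by (intro nth_equalityI) (auto intro: le_antisym)
  then show "A = B" using a(3) b(3) by metis
qed

lemma index_sets_hop:
  assumes B: "B \<subseteq> {..m}" "i \<in> B" "Suc i \<notin> B" "i < m"
    and A: "A = insert (Suc i) (B - {i})"
  shows "\<Sum>A = Suc (\<Sum>B)" "A \<in> index_sets (Suc m) r \<longleftrightarrow> B \<in> index_sets (Suc m) r"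
proof -
  have fin: "finite B" using B(1) by (rule finite_subset) simp
  have "\<Sum>B = i + \<Sum>(B - {i})" using fin B(2) by (rule sum.remove)
  then show "\<Sum>A = Suc (\<Sum>B)" using fin B by (simp add: A)
  have "card B = Suc (card (B - {i}))" using fin B(2) by (rule card.remove)
  then have "card A = card B" using fin B by (simp add: A)
  then show "A \<in> index_sets (Suc m) r \<longleftrightarrow> B \<in> index_sets (Suc m) r"
    using B A by (auto simp: index_sets_def)
qed

lemma hop_inverse:
  "i \<in> B \<and> Suc i \<notin> B \<and> A = insert (Suc i) (B - {i})
    \<longleftrightarrow> Suc i \<in> A \<and> i \<notin> A \<and> B = insert i (A - {Suc i})"
  by auto

text \<open>Identifies the part of degree -1 with the sum of single moves. The right-hand side has
  at most one nonzero term, because \<open>A\<close> and \<open>B\<close> determine the moved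
  index.\<close>

lemma shift_minor_succ:
  assumes A: "A \<in> index_sets (Suc m) r" and B: "B \<in> index_sets (Suc m) r" and AB: "\<Sum>A = Suc (\<Sum>B)"
  shows "shift_minor A B
    = (\<Sum>i<m. if i \<in> B \<and> Suc i \<notin> B \<and> A = insert (Suc i) (B - {i}) then 1 else 0)"
proof -
  define P where "P i \<longleftrightarrow> i \<in> B \<and> Suc i \<notin> B \<and> A = insert (Suc i) (B - {i})" for i
  note a = index_sets_sorted_list[OF A] and b = index_sets_sorted_list[OF B]
  let ?a = "sorted_list_of_set A" and ?b = "sorted_list_of_set B"
  have uniq: "i = j" if "P i" "P j" for i j
    using that unfolding P_def by (metis Diff_iff insertCI n_not_Suc_n insertE singletonD)
  have P_if: "\<exists>i<m. P i" if nz: "shift_minor A B \<noteq> 0"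
  proof -
    have step: "?a ! i = ?b ! i \<or> ?a ! i = Suc (?b ! i)" if "i < r" for i
      using nz that by (simp add: shift_minor_nonzero_iff[OF A])
    then have le: "?b ! i \<le> ?a ! i" if "i < r" for i using that by force
    \<comment> \<open>Every entry drops by 0 or 1 and the total drop is 1, so exactly one position
      \<open>j\<close> changes.\<close>
    have one: "(\<Sum>i<r. ?a ! i - ?b ! i) = 1"
      using le AB by (subst sum_subtractf_nat) (auto simp: sum_index_set[OF A] sum_index_set[OF B])
    then obtain j where j: "j < r" "?a ! j - ?b ! j = 1" "\<And>k. k < r \<Longrightarrow> k \<noteq> j \<Longrightarrow> ?a ! k - ?b ! k = 0"
      unfolding sum_eq_1_iff[OF finite_lessThan] by auto
    have aj: "?a ! j = Suc (?b ! j)" using step[OF j(1)] j(2) by auto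
    have ak: "?a ! k = ?b ! k" if "k < r" "k \<noteq> j" for k using step[OF that(1)] j(3)[OF that] by auto
    have upd: "?a = ?b[j := Suc (?b ! j)]"
      using aj ak j(1) a(2) b(2) by (intro nth_equalityI) (auto simp: nth_list_update)
    have "set ?a = insert (Suc (?b ! j)) (set ?b - {?b ! j})"
      using j(1) b(2) by (subst upd, intro set_update_distinct) auto
    then have A_eq: "A = insert (Suc (?b ! j)) (B - {?b ! j})" using a(3) b(3) by simp
    have "?b ! j \<in> B" using nth_mem[of j ?b] j(1) b(2,3) by simp
    \<comment> \<open>If this value stood at another position of \<open>B\<close>, that entry would
      be unchanged in \<open>A\<close> and collide with the raised one.\<close>
    moreover have "Suc (?b ! j) \<notin> B"
    proof
      assume "Suc (?b ! j) \<in> B"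
      then obtain k where k: "k < r" "?b ! k = Suc (?b ! j)" using b(2,3) by (metis in_set_conv_nth)
      then have "k \<noteq> j" by auto
      then have "?a ! k = ?a ! j" using ak k aj by simp
      moreover have "distinct ?a" by simp
      ultimately show False using \<open>k \<noteq> j\<close> k(1) j(1) a(2) by (metis nth_eq_iff_index_eq)
    qed
    moreover have "?b ! j < m" using A A_eq by (auto simp: index_sets_def)
    ultimately show ?thesis using A_eq unfolding P_def by blast
  qed
  have nz_if: "shift_minor A B \<noteq> 0" if i: "P i" for i
  proof -
    obtain j where j: "j < r" "?b ! j = i"
      using i b(2,3) unfolding P_def by (metis in_set_conv_nth)
    have lt: "?b ! p < ?b ! q" if "p < q" "q < r" for p q
      using sorted_wrt_nth_less[OF b(1) that(1)] that(2) b(2) by simp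
    \<comment> \<open>Later entries exceed \<open>i\<close> and avoid \<open>Suc i\<close>, since
      \<open>Suc i\<close> is not in \<open>B\<close>; so the raised list is still increasing and
      must be the sorted list of \<open>A\<close>.\<close>
    have "?b[j := Suc i] ! p < ?b[j := Suc i] ! q" if pq: "p < q" "q < r" for p q
    proof -
      have "?b ! q \<in> B" using nth_mem[of q ?b] pq b(2,3) by simp
      then have "?b ! q \<noteq> Suc i" using i unfolding P_def by auto
      then show ?thesis using lt[OF pq] j pq b(2) by (auto simp: nth_list_update)
    qed
    then have "sorted_wrt (<) (?b[j := Suc i])"
      using b(2) by (simp add: sorted_wrt_iff_nth_less)
    moreover have "set (?b[j := Suc i]) = insert (Suc i) (B - {i})"
      using set_update_distinct[of ?b j "Suc i"] j b(2,3) by simp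
    then have "set (?b[j := Suc i]) = A" using i unfolding P_def by simp
    ultimately have "?a = ?b[j := Suc i]"
      using a(1,3) strict_sorted_equal by metis
    then show ?thesis
      using j b(2) by (auto simp: shift_minor_nonzero_iff[OF A] nth_list_update)
  qed
  show ?thesis
  proof (cases "\<exists>i<m. P i")
    case True
    then obtain i where i: "i < m" "P i" by blast
    have "(\<Sum>k<m. if P k then 1 else 0 :: int) = (\<Sum>k<m. if k = i then 1 else 0)"
      using uniq i by (intro sum.cong) auto
    then show ?thesis
      using i nz_if[OF i(2)] shift_minor_cases[of A B] unfolding P_def by simp
  next
    case False
    then have "(\<Sum>k<m. if P k then 1 else 0 :: int) = 0" by (intro sum.neutral) auto
    then show ?thesis using False P_if unfolding P_def by fastforce
  qed
qed

text \<open>With \<open>g\<close> confined to the degree just above \<open>B\<close>, only entries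
  given by \<open>shift_minor_succ\<close> survive. After exchanging the sums, each \<open>i\<close>
  singles out at most one \<open>A\<close>.\<close>

lemma sum_shift_minor_lowering:
  fixes g :: "nat set \<Rightarrow> real"
  assumes g: "\<And>A. g A \<noteq> 0 \<Longrightarrow> A \<in> index_sets (Suc m) r \<and> \<Sum>A = Suc (\<Sum>B)"
    and B: "B \<in> index_sets (Suc m) r"
  shows "(\<Sum>A\<in>index_sets (Suc m) r. g A * of_int (shift_minor A B)) = lowering m g B"
proof -
  let ?I = "index_sets (Suc m) r"
  have "(\<Sum>A\<in>?I. g A * of_int (shift_minor A B)) = (\<Sum>A\<in>?I. \<Sum>i<m.
      if i \<in> B \<and> Suc i \<notin> B \<and> A = insert (Suc i) (B - {i}) then g A else 0)"
  proof (intro sum.cong refl)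
    fix A assume A: "A \<in> ?I"
    show "g A * of_int (shift_minor A B) = (\<Sum>i<m.
      if i \<in> B \<and> Suc i \<notin> B \<and> A = insert (Suc i) (B - {i}) then g A else 0)"
    proof (cases "g A = 0")
      case False
      then have "shift_minor A B
          = (\<Sum>i<m. if i \<in> B \<and> Suc i \<notin> B \<and> A = insert (Suc i) (B - {i}) then 1 else 0)"
        using g by (intro shift_minor_succ[OF A B]) auto
      then show ?thesis by (simp add: sum_distrib_left if_distrib cong: if_cong)
    qed (simp, intro sum.neutral, auto)
  qed
  also have "\<dots> = (\<Sum>i<m. \<Sum>A\<in>?I.
      if i \<in> B \<and> Suc i \<notin> B \<and> A = insert (Suc i) (B - {i}) then g A else 0)"
    by (rule sum.swap)
  also have "\<dots> = (\<Sum>i<m. hop i (Suc i) g B)"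
  proof (intro sum.cong refl)
    fix i
    show "(\<Sum>A\<in>?I. if i \<in> B \<and> Suc i \<notin> B \<and> A = insert (Suc i) (B - {i}) then g A else 0)
        = hop i (Suc i) g B"
    proof (cases "i \<in> B \<and> Suc i \<notin> B")
      case True
      then show ?thesis using g by (auto simp: hop_def)
    qed (auto simp: hop_def)
  qed
  finally show ?thesis unfolding lowering_def .
qed

lemma sum_shift_minor_transpose:
  fixes g :: "nat set \<Rightarrow> real"
  assumes g: "\<And>B. g B \<noteq> 0 \<Longrightarrow> B \<in> index_sets (Suc m) r \<and> \<Sum>A = Suc (\<Sum>B)"
    and A: "A \<in> index_sets (Suc m) r"
  shows "(\<Sum>B\<in>index_sets (Suc m) r. g B * of_int (shift_minor A B)) = (\<Sum>i<m. hop (Suc i) i g A)"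
proof -
  let ?I = "index_sets (Suc m) r"
  have "(\<Sum>B\<in>?I. g B * of_int (shift_minor A B)) = (\<Sum>B\<in>?I. \<Sum>i<m.
      if Suc i \<in> A \<and> i \<notin> A \<and> B = insert i (A - {Suc i}) then g B else 0)"
  proof (intro sum.cong refl)
    fix B assume B: "B \<in> ?I"
    show "g B * of_int (shift_minor A B) = (\<Sum>i<m.
      if Suc i \<in> A \<and> i \<notin> A \<and> B = insert i (A - {Suc i}) then g B else 0)"
    proof (cases "g B = 0")
      case False
      then have "shift_minor A B
          = (\<Sum>i<m. if i \<in> B \<and> Suc i \<notin> B \<and> A = insert (Suc i) (B - {i}) then 1 else 0)"
        using g by (intro shift_minor_succ[OF A B]) auto
      then show ?thesis unfolding hop_inverse by (simp add: sum_distrib_left if_distrib cong: if_cong)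
    qed (simp, intro sum.neutral, auto)
  qed
  also have "\<dots> = (\<Sum>i<m. \<Sum>B\<in>?I.
      if Suc i \<in> A \<and> i \<notin> A \<and> B = insert i (A - {Suc i}) then g B else 0)"
    by (rule sum.swap)
  also have "\<dots> = (\<Sum>i<m. hop (Suc i) i g A)"
  proof (intro sum.cong refl)
    fix i
    show "(\<Sum>B\<in>?I. if Suc i \<in> A \<and> i \<notin> A \<and> B = insert i (A - {Suc i}) then g B else 0)
        = hop (Suc i) i g A"
    proof (cases "Suc i \<in> A \<and> i \<notin> A")
      case True
      then show ?thesis using g by (auto simp: hop_def)
    qed (auto simp: hop_def)
  qed
  finally show ?thesis .
qed

section \<open>Extreme components of fixed vectors and of row relations\<close>

text \<open>Let \<open>k\<close> be the top degree of \<open>x\<close>. In degree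
  \<open>k - 1\<close> the diagonal of the shift cancels the right-hand side of the fixed-point
  equation, and only \<open>E\<close> applied to the top component remains. A bad \<open>A\<close>
  would put \<open>k\<close> above the middle, where \<open>E\<close> is injective.\<close>

lemma shift_fixed_support:
  fixes x :: "nat set \<Rightarrow> int"
  assumes fixed: "\<And>B. B \<in> index_sets (Suc m) r \<Longrightarrow>
      (\<Sum>A\<in>index_sets (Suc m) r. x A * shift_minor A B) = x B"
    and A: "A \<in> index_sets (Suc m) r" "r * m < 2 * \<Sum>A"
  shows "x A = 0"
proof (rule ccontr)
  let ?I = "index_sets (Suc m) r"
  assume "x A \<noteq> 0"
  define k where "k = Max (Sum ` {A \<in> ?I. x A \<noteq> 0})"
  have fin: "finite (Sum ` {A \<in> ?I. x A \<noteq> 0})" by simp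
  have max: "\<Sum>C \<le> k" if "C \<in> ?I" "x C \<noteq> 0" for C
    unfolding k_def using that by (intro Max_ge fin) auto
  have "k \<in> Sum ` {A \<in> ?I. x A \<noteq> 0}"
    unfolding k_def using A(1) \<open>x A \<noteq> 0\<close> by (intro Max_in fin) auto
  then obtain C where C: "C \<in> ?I" "x C \<noteq> 0" "\<Sum>C = k" by auto
  have k: "r * m < 2 * k" using max[OF A(1) \<open>x A \<noteq> 0\<close>] A(2) by linarith
  define g :: "nat set \<Rightarrow> real" where "g A = (if A \<in> ?I \<and> \<Sum>A = k then of_int (x A) else 0)" for A
  have gD: "A \<in> ?I \<and> \<Sum>A = k" if "g A \<noteq> 0" for A
    using that unfolding g_def by (rule contrapos_np) (rule if_not_P)
  have "lowering m g B = 0" if B: "B \<subseteq> {..m}" for B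
  \<comment> \<open>The fixed-point equation is used only one degree below the top. Elsewhere no
    move from \<open>B\<close> reaches a set of \<open>?I\<close> in degree \<open>k\<close>, where
    \<open>g\<close> lives.\<close>
  proof (cases "B \<in> ?I \<and> Suc (\<Sum>B) = k")
    case True
    have "(\<Sum>A\<in>?I. of_int (x A * shift_minor A B))
        = (\<Sum>A\<in>?I. (if A = B then of_int (x B) else 0) + g A * of_int (shift_minor A B))"
    proof (intro sum.cong refl)
      fix A assume A: "A \<in> ?I"
      show "of_int (x A * shift_minor A B)
          = (if A = B then of_int (x B) else 0) + g A * of_int (shift_minor A B)"
      proof (cases "A \<noteq> B \<and> shift_minor A B \<noteq> 0 \<and> x A \<noteq> 0")
        case nz: True
        \<comment> \<open>A surviving off-diagonal term lies above degree \<open>k - 1\<close> and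
          not above \<open>k\<close>, hence belongs to the top component.\<close>
        then have "\<Sum>B < \<Sum>A" "\<Sum>A \<le> k"
          using shift_minor_nonzeroD[OF A, of B] True max[OF A] by blast+
        then have "\<Sum>A = k" using True by linarith
        then show ?thesis using nz A by (simp add: g_def)
      next
        case False
        show ?thesis
        proof (cases "A = B")
          case AB: True
          then have "g A = 0" using gD[of A] True by (metis n_not_Suc_n)
          then show ?thesis using AB by (simp add: shift_minor_refl)
        next
          case AB: False
          have "g A = 0" if "x A = 0" using that by (simp add: g_def)
          then show ?thesis using AB False by (cases "x A = 0") simp_all
        qed
      qed
    qed
    also have "\<dots> = of_int (x B) + (\<Sum>A\<in>?I. g A * of_int (shift_minor A B))"
      using True by (simp add: sum.distrib)
    also have "(\<Sum>A\<in>?I. of_int (x A * shift_minor A B)) = (of_int (x B) :: real)"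
      using arg_cong[OF fixed[of B], of real_of_int] True by simp
    finally have "(\<Sum>A\<in>?I. g A * of_int (shift_minor A B)) = 0" by simp
    moreover have "(\<Sum>A\<in>?I. g A * of_int (shift_minor A B)) = lowering m g B"
    proof (rule sum_shift_minor_lowering)
      show "A \<in> ?I \<and> \<Sum>A = Suc (\<Sum>B)" if "g A \<noteq> 0" for A
        using gD[OF that] True by presburger
      show "B \<in> ?I" using True by blast
    qed
    ultimately show ?thesis by simp
  next
    case False
    have "hop i (Suc i) g B = 0" if i: "i < m" for i
    proof (cases "i \<in> B \<and> Suc i \<notin> B")
      case True
      define A where "A = insert (Suc i) (B - {i})"
      have "\<Sum>A = Suc (\<Sum>B)" "A \<in> ?I \<longleftrightarrow> B \<in> ?I"
        using index_sets_hop[OF B _ _ i A_def] True by simp_all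
      then have "g A = 0" using False gD[of A] by auto
      then show ?thesis by (simp add: hop_def A_def)
    qed (auto simp: hop_def)
    then show ?thesis by (simp add: lowering_def)
  qed
  moreover have "m * card B < 2 * \<Sum>B" if "B \<subseteq> {..m}" "g B \<noteq> 0" for B
  proof -
    have "card B = r" using gD[OF that(2)] by (simp add: index_sets_def)
    then show ?thesis using k gD[OF that(2)] by (simp add: mult.commute)
  qed
  moreover have "C \<subseteq> {..m}" using C(1) by (simp add: index_sets_def lessThan_Suc_atMost)
  ultimately have "g C = 0" by - (rule lowering_injective[of m g C])
  then show False using C by (simp add: g_def)
qed

text \<open>The mirror image, with the bottom degree \<open>k\<close> of the relation
  \<open>d\<close>. In a column of degree \<open>k + 1\<close> only rows of degree \<open>k\<close>
  can contribute, so the transpose of \<open>E\<close> annihilates the bottom component, and it is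
  injective below the middle.\<close>

lemma shift_rows_independent:
  fixes d :: "nat set \<Rightarrow> int" and m r :: nat
  defines "I \<equiv> index_sets (Suc m) r" and "\<mu> \<equiv> r * m div 2"
  assumes zero: "\<And>A. A \<in> I \<Longrightarrow> \<Sum>A \<le> \<mu> \<Longrightarrow>
      (\<Sum>B\<in>{B \<in> I. \<Sum>B < \<mu>}. d B * (shift_minor A B - (if A = B then 1 else 0))) = 0"
    and B0: "B0 \<in> I" "\<Sum>B0 < \<mu>"
  shows "d B0 = 0"
proof (rule ccontr)
  let ?J = "{B \<in> I. \<Sum>B < \<mu>}"
  assume "d B0 \<noteq> 0"
  define k where "k = Min (Sum ` {B \<in> ?J. d B \<noteq> 0})"
  have fin: "finite I" "finite (Sum ` {B \<in> ?J. d B \<noteq> 0})" by (simp_all add: I_def)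
  have min: "k \<le> \<Sum>C" if "C \<in> ?J" "d C \<noteq> 0" for C
    unfolding k_def using that by (intro Min_le fin) auto
  have "k \<in> Sum ` {B \<in> ?J. d B \<noteq> 0}"
    unfolding k_def using B0 \<open>d B0 \<noteq> 0\<close> by (intro Min_in fin) auto
  then obtain C where C: "C \<in> ?J" "d C \<noteq> 0" "\<Sum>C = k" by auto
  \<comment> \<open>Used twice: columns of degree \<open>k + 1\<close> are still among those covered
    by \<open>zero\<close>, and \<open>2 * k < r * m\<close> holds whatever the parity of
    \<open>r * m\<close>.\<close>
  then have k: "Suc k \<le> \<mu>" by simp
  define g :: "nat set \<Rightarrow> real" where "g B = (if B \<in> ?J \<and> \<Sum>B = k then of_int (d B) else 0)" for B
  have gD: "B \<in> ?J \<and> \<Sum>B = k" if "g B \<noteq> 0" for B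
    using that unfolding g_def by (rule contrapos_np) (rule if_not_P)
  have "(\<Sum>i<m. hop (Suc i) i g A) = 0" if A: "A \<subseteq> {..m}" for A
  proof (cases "A \<in> I \<and> \<Sum>A = Suc k")
    case True
    have "(\<Sum>B\<in>I. g B * of_int (shift_minor A B)) = (\<Sum>B\<in>?J. g B * of_int (shift_minor A B))"
      using fin by (intro sum.mono_neutral_right) (auto simp: g_def)
    also have "\<dots> = (\<Sum>B\<in>?J. of_int (d B * (shift_minor A B - (if A = B then 1 else 0))))"
    proof (intro sum.cong refl)
      fix B assume B: "B \<in> ?J"
      show "g B * of_int (shift_minor A B) = of_int (d B * (shift_minor A B - (if A = B then 1 else 0)))"
      proof (cases "A \<noteq> B \<and> shift_minor A B \<noteq> 0 \<and> d B \<noteq> 0")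
        case nz: True
        then have "\<Sum>B < \<Sum>A" "k \<le> \<Sum>B"
          using shift_minor_nonzeroD[of A "Suc m" r B] B True min[OF B] unfolding I_def by blast+
        then have "\<Sum>B = k" using True by linarith
        then show ?thesis using nz B by (simp add: g_def)
      next
        case False
        show ?thesis
        proof (cases "A = B")
          case AB: True
          then have "g B = 0" using gD[of B] True by (metis n_not_Suc_n)
          then show ?thesis using AB by (simp add: shift_minor_refl)
        next
          case AB: False
          have "g B = 0" if "d B = 0" using that by (simp add: g_def)
          then show ?thesis using AB False by (cases "d B = 0") simp_all
        qed
      qed
    qed
    also have "\<dots> = of_int (\<Sum>B\<in>?J. d B * (shift_minor A B - (if A = B then 1 else 0)))" by simp
    also have "\<dots> = 0" using zero[of A] True k by simp
    finally have "(\<Sum>B\<in>I. g B * of_int (shift_minor A B)) = 0" .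
    moreover have "(\<Sum>B\<in>I. g B * of_int (shift_minor A B)) = (\<Sum>i<m. hop (Suc i) i g A)"
      unfolding I_def
    proof (rule sum_shift_minor_transpose)
      show "B \<in> index_sets (Suc m) r \<and> \<Sum>A = Suc (\<Sum>B)" if "g B \<noteq> 0" for B
        using gD[OF that] True unfolding I_def by blast
      show "A \<in> index_sets (Suc m) r" using True unfolding I_def by blast
    qed
    ultimately show ?thesis by simp
  next
    case False
    have "hop (Suc i) i g A = 0" if i: "i < m" for i
    proof (cases "Suc i \<in> A \<and> i \<notin> A")
      case True
      define B where "B = insert i (A - {Suc i})"
      have "A - {Suc i} \<subseteq> {..m}" using A by blast
      then have B: "B \<subseteq> {..m}" "i \<in> B" "Suc i \<notin> B" using i by (simp_all add: B_def)
      have A_eq: "A = insert (Suc i) (B - {i})" using True unfolding B_def by blast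
      have "\<Sum>A = Suc (\<Sum>B)" "A \<in> I \<longleftrightarrow> B \<in> I"
        using index_sets_hop[OF B i A_eq] unfolding I_def by simp_all
      then have "g B = 0" using False gD[of B] by auto
      then show ?thesis using True by (simp add: hop_def B_def)
    qed (auto simp: hop_def)
    then show ?thesis by simp
  qed
  moreover have "2 * \<Sum>B < m * card B" if "B \<subseteq> {..m}" "g B \<noteq> 0" for B
  proof -
    have "card B = r" using gD[OF that(2)] by (simp add: I_def index_sets_def)
    moreover have "2 * k < r * m" using k unfolding \<mu>_def by linarith
    ultimately show ?thesis using gD[OF that(2)] by (simp add: mult.commute)
  qed
  moreover have "C \<subseteq> {..m}" using C(1) by (simp add: I_def index_sets_def lessThan_Suc_atMost)
  ultimately have "g C = 0" by - (rule hop_transpose_injective[of m g C])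
  then show False using C by (simp add: g_def)
qed

section \<open>Counting in the middle degree\<close>

lemma card_middle_index_sets:
  fixes n r \<mu> :: nat
  defines "I \<equiv> index_sets n r"
  shows "card {A \<in> I. \<Sum>A \<le> \<mu>} - card {A \<in> I. \<Sum>A < \<mu>} = card {A \<in> I. \<Sum>A = \<mu>}"
proof -
  have "{A \<in> I. \<Sum>A \<le> \<mu>} = {A \<in> I. \<Sum>A < \<mu>} \<union> {A \<in> I. \<Sum>A = \<mu>}" by auto
  then have "card {A \<in> I. \<Sum>A \<le> \<mu>} = card {A \<in> I. \<Sum>A < \<mu>} + card {A \<in> I. \<Sum>A = \<mu>}"
    by (simp add: card_Un_disjoint disjoint_iff I_def)
  then show ?thesis by simp
qed

text \<open>Fixed classes are described by their coordinates in degrees at most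
  \<open>\<mu>\<close>, subject to the equations in degrees below \<open>\<mu>\<close>. These
  equations are independent, so the rank is the difference of the two counts.\<close>

lemma a_coeff_eq_card:
  fixes m r :: nat
  defines "I \<equiv> index_sets (Suc m) r" and "\<mu> \<equiv> r * m div 2"
  shows "a_coeff (Suc m) r = enat (card {A \<in> I. \<Sum>A = \<mu>})"
proof -
  let ?n = "Suc m"
  let ?I = "{A \<in> I. \<Sum>A \<le> \<mu>}" and ?J = "{A \<in> I. \<Sum>A < \<mu>}"
  \<comment> \<open>Row \<open>B\<close> of \<open>D\<close> is the coordinate at \<open>B\<close>
    of the shift minus the identity, and \<open>A\<close> runs over the unknowns.\<close>
  define D :: "nat set \<Rightarrow> nat set \<Rightarrow> int" where "D B A = shift_minor A B - (if A = B then 1 else 0)" for A B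
  have finI: "finite I" by (simp add: I_def)
  have middle: "r * m < 2 * \<Sum>A" if "\<not> \<Sum>A \<le> \<mu>" for A
    using that unfolding \<mu>_def by linarith
  have sum_D: "(\<Sum>A\<in>?I. D B A * f A) = (\<Sum>A\<in>I. f A * shift_minor A B) - f B"
    if f: "\<And>A. A \<in> I \<Longrightarrow> \<not> \<Sum>A \<le> \<mu> \<Longrightarrow> f A = 0" and B: "B \<in> I" for f :: "nat set \<Rightarrow> int" and B
  proof -
    have "(\<Sum>A\<in>?I. D B A * f A) = (\<Sum>A\<in>I. D B A * f A)"
      using finI f by (intro sum.mono_neutral_left) auto
    also have "\<dots> = (\<Sum>A\<in>I. f A * shift_minor A B - (if A = B then f B else 0))"
      by (intro sum.cong refl) (simp add: D_def algebra_simps)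
    also have "\<dots> = (\<Sum>A\<in>I. f A * shift_minor A B) - f B"
      using finI B by (simp add: sum_subtractf)
    finally show ?thesis .
  qed
  have fixed_class: "\<exists>x. X = wedge_class ?n r x \<and> Poly_Mapping.keys x \<subseteq> vec_tuples ?n r \<and>
      class_coord ?n r X = Poly_Mapping.lookup (wedge_coords ?n r x) \<and>
      (\<forall>B\<in>I. (\<Sum>A\<in>I. class_coord ?n r X A * shift_minor A B) = class_coord ?n r X B)"
    if "X \<in> carrier (fixed_part ?n r)" for X
    using that wedge_map_fixed_iff[of _ ?n r]
    by (auto simp: carrier_fixed_part class_coord_wedge_class I_def)
  have support: "class_coord ?n r X A = 0"
    if X: "X \<in> carrier (fixed_part ?n r)" and A: "A \<in> I" "\<not> \<Sum>A \<le> \<mu>" for X A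
    using fixed_class[OF X] A(1) middle[OF A(2)] unfolding I_def by (intro shift_fixed_support) auto
  have "group_rank (fixed_part ?n r) = enat (card ?I - card ?J)"
  proof (rule group_rank_kernel[where h = "class_coord ?n r" and A = D])
    show "comm_group (fixed_part ?n r)" by (rule comm_group_fixed_part)
    show "finite ?I" "finite ?J" using finI by simp_all
  next
    fix X Y A
    assume X: "X \<in> carrier (fixed_part ?n r)" and Y: "Y \<in> carrier (fixed_part ?n r)"
    obtain x where x: "X = wedge_class ?n r x" "Poly_Mapping.keys x \<subseteq> vec_tuples ?n r"
      using fixed_class[OF X] by blast
    obtain y where y: "Y = wedge_class ?n r y" "Poly_Mapping.keys y \<subseteq> vec_tuples ?n r"
      using fixed_class[OF Y] by blast
    have "X \<otimes>\<^bsub>fixed_part ?n r\<^esub> Y = wedge_class ?n r (x + y)"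
      using x y by (simp add: fixed_part_def wedge_class_mult)
    then show "class_coord ?n r (X \<otimes>\<^bsub>fixed_part ?n r\<^esub> Y) A
        = class_coord ?n r X A + class_coord ?n r Y A"
      by (simp add: x y class_coord_wedge_class wedge_coords_add Poly_Mapping.lookup_add)
  next
    \<comment> \<open>Coordinates in degrees at most \<open>\<mu>\<close> already determine the
      class, since \<open>support\<close> makes the others vanish.\<close>
    fix X assume X: "X \<in> carrier (fixed_part ?n r)" and zero: "\<forall>A\<in>?I. class_coord ?n r X A = 0"
    obtain x where x: "X = wedge_class ?n r x" "Poly_Mapping.keys x \<subseteq> vec_tuples ?n r"
      "class_coord ?n r X = Poly_Mapping.lookup (wedge_coords ?n r x)"
      using fixed_class[OF X] by blast
    have "class_coord ?n r X A = 0" for A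
    proof (cases "A \<in> I")
      case True
      then show ?thesis using zero support[OF X True] by blast
    next
      case False
      then show ?thesis unfolding x(3) I_def by (rule lookup_wedge_coords_outside)
    qed
    then have "wedge_coords ?n r x = 0" by (intro poly_mapping_eqI) (simp flip: x(3))
    then have "x - 0 \<in> wedge_null ?n r" using x(2) by (simp add: wedge_null_iff_coords)
    then have "X = wedge_class ?n r 0" unfolding x(1) wedge_class_eq_iff .
    then show "X = \<one>\<^bsub>fixed_part ?n r\<^esub>" by (simp add: fixed_part_def wedge_class_zero)
  next
    fix X B assume X: "X \<in> carrier (fixed_part ?n r)" and B: "B \<in> ?J"
    then show "(\<Sum>A\<in>?I. D B A * class_coord ?n r X A) = 0"
      using sum_D[of "class_coord ?n r X" B] support[OF X] fixed_class[OF X] by auto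
  next
    fix f :: "nat set \<Rightarrow> int"
    assume f: "\<forall>B\<in>?J. (\<Sum>A\<in>?I. D B A * f A) = 0"
    \<comment> \<open>Extension by zero to all degrees; the class realizing \<open>f\<close> has
      these coordinates.\<close>
    define g where "g A = (if A \<in> ?I then f A else 0)" for A
    define y where "y = (\<Sum>A\<in>?I. frag_cmul (g A) (frag_of A))"
    have "Poly_Mapping.keys y \<subseteq> (\<Union>A\<in>?I. Poly_Mapping.keys (frag_cmul (g A) (frag_of A)))"
      unfolding y_def by (rule keys_sum)
    also have "\<dots> \<subseteq> I" by (auto split: if_splits)
    finally have keys: "Poly_Mapping.keys y \<subseteq> index_sets ?n r" by (simp add: I_def)
    have "Poly_Mapping.lookup y A = (\<Sum>B\<in>?I. if A = B then g B else 0)" for A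
      unfolding y_def Poly_Mapping.lookup_sum by (intro sum.cong) auto
    then have y: "Poly_Mapping.lookup y A = g A" for A
      using finI by (simp add: g_def)
    define x where "x = basis_combination ?n y"
    have x: "Poly_Mapping.keys x \<subseteq> vec_tuples ?n r" "wedge_coords ?n r x = y"
      unfolding x_def by (rule keys_basis_combination[OF keys], rule wedge_coords_basis_combination[OF keys])
    have "(\<Sum>A\<in>I. g A * shift_minor A B) = g B" if B: "B \<in> I" for B
    proof (cases "B \<in> ?J")
      case True
      have "(\<Sum>A\<in>?I. D B A * g A) = (\<Sum>A\<in>?I. D B A * f A)"
        by (intro sum.cong) (auto simp: g_def)
      then have "(\<Sum>A\<in>?I. D B A * g A) = 0" using f True by simp
      then show ?thesis using sum_D[of g B] B by (simp add: g_def)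
    next
      case False
      \<comment> \<open>Here \<open>B\<close> has degree at least \<open>\<mu>\<close>, while
        \<open>g\<close> lives in degrees at most \<open>\<mu>\<close>. Triangularity leaves only
        the diagonal term, so the equation holds automatically.\<close>
      have "(\<Sum>A\<in>I. g A * shift_minor A B) = (\<Sum>A\<in>I. if A = B then g B else 0)"
      proof (intro sum.cong refl)
        fix A assume A: "A \<in> I"
        show "g A * shift_minor A B = (if A = B then g B else 0)"
        proof (cases "A = B \<or> g A = 0")
          case True
          then show ?thesis by (auto simp: shift_minor_refl)
        next
          case nz: False
          then have "\<not> \<Sum>B < \<Sum>A" using False B by (auto simp: g_def split: if_splits)
          then show ?thesis
            using nz shift_minor_nonzeroD[of A ?n r B] A B unfolding I_def by auto
        qed
      qed
      then show ?thesis using finI B by simp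
    qed
    then have "wedge_map (S_mat ?n) x - x \<in> wedge_null ?n r"
      using wedge_map_fixed_iff[OF x(1)] by (simp add: x(2) y I_def)
    then have "wedge_class ?n r x \<in> carrier (fixed_part ?n r)"
      unfolding carrier_fixed_part using x(1) by blast
    moreover have "class_coord ?n r (wedge_class ?n r x) A = f A" if "A \<in> ?I" for A
      using that by (simp add: class_coord_wedge_class x(2) y g_def)
    ultimately show "\<exists>X\<in>carrier (fixed_part ?n r). \<forall>A\<in>?I. class_coord ?n r X A = f A" by blast
  next
    fix d assume "\<forall>A\<in>?I. (\<Sum>B\<in>?J. d B * D B A) = 0"
    then show "\<forall>B\<in>?J. d B = 0"
      using shift_rows_independent[of m r d] unfolding D_def I_def \<mu>_def by blast
  qed
  then show ?thesis
    using card_middle_index_sets[of ?n r \<mu>] by (simp add: a_coeff_def I_def)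
qed

text \<open>Indices start at 0 and parts at 1. Adding one to each of the \<open>r\<close> indices
  raises the sum by \<open>r\<close>.\<close>

lemma partition_count_eq_card:
  "partition_count n r (r + k) = card {A \<in> index_sets n r. \<Sum>A = k}"
proof -
  let ?P = "{is :: nat list. length is = r \<and> sum_list is = r + k \<and> sorted_wrt (<) is \<and> set is \<subseteq> {1..n}}"
  have "bij_betw (\<lambda>A. map Suc (sorted_list_of_set A)) {A \<in> index_sets n r. \<Sum>A = k} ?P"
  proof (rule bij_betwI[where g = "\<lambda>is. (\<lambda>i. i - 1) ` set is"])
    have "map Suc (sorted_list_of_set A) \<in> ?P" if A: "A \<in> index_sets n r" "\<Sum>A = k" for A
    proof -
      note a = index_sets_sorted_list[OF A(1)]
      have "sum_list (map Suc xs) = length xs + sum_list xs" for xs by (induction xs) auto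
      moreover have "sum_list (sorted_list_of_set A) = \<Sum>A"
        using a sum_list_distinct_conv_sum_set[of "sorted_list_of_set A" "\<lambda>x. x"] by simp
      moreover have "A \<subseteq> {..<n}" using A(1) by (simp add: index_sets_def)
      ultimately show ?thesis using a A(2) by (auto simp: sorted_wrt_map)
    qed
    then show "(\<lambda>A. map Suc (sorted_list_of_set A)) \<in> {A \<in> index_sets n r. \<Sum>A = k} \<rightarrow> ?P" by blast
  next
    have "(\<lambda>i. i - 1) ` set is \<in> {A \<in> index_sets n r. \<Sum>A = k}
        \<and> map Suc (sorted_list_of_set ((\<lambda>i. i - 1) ` set is)) = is" if "is \<in> ?P" for "is"
    proof -
      let ?js = "map (\<lambda>i. i - 1) is"
      have pos: "1 \<le> i" "i \<le> n" if "i \<in> set is" for i using \<open>is \<in> ?P\<close> that by auto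
      have Suc_js: "map Suc ?js = is" unfolding map_map by (rule map_idI) (use pos in force)
      have len: "length ?js = r" using that by simp
      have "sorted_wrt (<) (map Suc ?js)" unfolding Suc_js using that by simp
      then have sorted: "sorted_wrt (<) ?js" by (simp add: sorted_wrt_map)
      then have dist: "distinct ?js" by (simp only: strict_sorted_iff)
      have "sum_list (map Suc xs) = length xs + sum_list xs" for xs by (induction xs) auto
      from this[of ?js] have "sum_list ?js = k" unfolding Suc_js using that by simp
      then have "\<Sum>(set ?js) = k"
        using sum_list_distinct_conv_sum_set[OF dist, of "\<lambda>x. x"] by simp
      moreover have "card (set ?js) = r" using distinct_card[OF dist] len by simp
      moreover have "set ?js \<subseteq> {..<n}" using pos by fastforce
      moreover have "sorted_list_of_set (set ?js) = ?js"
        using sorted strict_sorted_equal[of ?js "sorted_list_of_set (set ?js)"] by simp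
      ultimately show ?thesis using Suc_js by (simp add: index_sets_def)
    qed
    then show "(\<lambda>is. (\<lambda>i. i - 1) ` set is) \<in> ?P \<rightarrow> {A \<in> index_sets n r. \<Sum>A = k}"
      and "\<And>is. is \<in> ?P \<Longrightarrow> map Suc (sorted_list_of_set ((\<lambda>i. i - 1) ` set is)) = is" by blast+
    show "(\<lambda>i. i - 1) ` set (map Suc (sorted_list_of_set A)) = A"
      if "A \<in> {A \<in> index_sets n r. \<Sum>A = k}" for A
    proof -
      have "finite A" using that index_sets_sorted_list(4) by blast
      then show ?thesis by (simp add: image_image)
    qed
  qed
  from bij_betw_same_card[OF this] show ?thesis by (simp only: partition_count_def)
qed

text \<open>The formula expressing the ranks of both K-groups as the sum of the
  \<open>a_coeff n r\<close> enters as the premise of the implication; the values of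
  \<open>a_coeff\<close> are then substituted into it.\<close>

theorem theorem6p3:
  fixes n :: nat and \<theta> :: real
  assumes "1 \<le> n"
  shows "(\<forall>r\<le>n. a_coeff n r = enat (partition_count n r (r * (n + 1) div 2))) \<and>
    (group_rank (K0 (anzai_cstar n \<theta>)) = (\<Sum>r=0..n. a_coeff n r) \<and>
     group_rank (K1 (anzai_cstar n \<theta>)) = (\<Sum>r=0..n. a_coeff n r) \<longrightarrow>
     group_rank (K0 (anzai_cstar n \<theta>)) = enat (\<Sum>r=0..n. partition_count n r (r * (n + 1) div 2)) \<and>
     group_rank (K1 (anzai_cstar n \<theta>)) = enat (\<Sum>r=0..n. partition_count n r (r * (n + 1) div 2)))"
proof -
  obtain m where n: "n = Suc m" using assms by (cases n) auto
  have coeff: "a_coeff n r = enat (partition_count n r (r * (n + 1) div 2))" for r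
  proof -
    \<comment> \<open>Since \<open>n + 1 = m + 2\<close>, the target sum is the middle degree
      \<open>r * m div 2\<close> plus exactly the \<open>r\<close> units gained in passing from
      indices to parts.\<close>
    have "r * (n + 1) = r * m + r * 2" by (simp add: n algebra_simps)
    then have "r * (n + 1) div 2 = r + r * m div 2" by simp
    then show ?thesis
      unfolding n by (simp only: a_coeff_eq_card partition_count_eq_card)
  qed
  have sum_enat: "(\<Sum>r\<in>S. enat (f r)) = enat (\<Sum>r\<in>S. f r)" for f :: "nat \<Rightarrow> nat" and S
    by (induction S rule: infinite_finite_induct) (simp_all add: zero_enat_def)
  have total: "(\<Sum>r=0..n. a_coeff n r) = enat (\<Sum>r=0..n. partition_count n r (r * (n + 1) div 2))"
    unfolding coeff by (rule sum_enat)
  show ?thesis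
    unfolding total by (intro conjI allI impI coeff; elim conjE; assumption)
qed

end
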